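(* Let $(\mathcal{V},\bullet,\mathbf{I};\omega)$ be a semiunital semimonoidal category and let $\mathbb{J}:=\mathbf{I}\bullet-\simeq-\bullet\mathbf{I}:\mathcal{V}\to\mathcal{V}$. Assume that $\mathcal{V}$ is cocomplete, that $\mathbf{I}$ and $A\in\mathcal{V}$ are firm, that $\mathbf{I}$ is a regular generator in $\mathcal{V}$, and that both functors $A\bullet-$ and $-\bullet A:\mathcal{V}\to\mathcal{V}$ preserve colimits. Then there is a bijective correspondence between: the $\mathcal{V}$-semimonoid structures $(A,\mu,\eta)$ on $A$; the $\mathbb{J}$-monad structures $(-\bullet A,\boldsymbol{\mu},\omega,\boldsymbol{\nu};\mathbb{J})$ on the endofunctor $-\bullet A$; and the $\mathbb{J}$-monad structures $(A\bullet-,\boldsymbol{\mu},\omega,\boldsymbol{\nu};\mathbb{J})$ on the endofunctor $A\bullet-$.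
   Context: A semimonoidal category $(\mathcal{V},\bullet)$ is a category with a bifunctor $\bullet$ and natural associativity isomorphisms $\gamma_{X,Y,Z}:(X\bullet Y)\bullet Z\to X\bullet(Y\bullet Z)$ satisfying the pentagon axiom (a monoidal category without a unit). Objects are also used to denote their identity morphisms, and associativity isomorphisms are suppressed where harmless. An object $\mathbf{I}$ is a semiunit, and $(\mathcal{V},\bullet,\mathbf{I};\omega)$ is called semiunital semimonoidal, if there are: a natural transformation $\omega_X:X\to\mathbf{I}\bullet X$; and a natural isomorphism $\ell_X:\mathbf{I}\bullet X\to X\bullet\mathbf{I}$ with inverse $\wp_X$ such that $\ell_{\mathbf{I}}=\wp_{\mathbf{I}}$ and, for all $X,Y$, $$\gamma_{X,Y,\mathbf{I}}\circ\ell_{X\bullet Y}\circ\gamma_{\mathbf{I},X,Y}=(X\bullet\ell_Y)\circ\gamma_{X,\mathbf{I},Y}\circ(\ell_X\bullet Y),$$ $$\omega_{X\bullet Y}=\gamma_{\mathbf{I},X,Y}\circ(\omega_X\bullet Y)=\gamma_{\mathbf{I},X,Y}\circ(\wp_X\bullet Y)\circ\gamma_{X,\mathbf{I},Y}^{-1}\circ(X\bullet\omega_Y).$$ These data are fixed. An object $X$ is firm if $\omega_X$ is an isomorphism. A $\mathcal{V}$-semimonoid structure on $A$ is a pair of morphisms $\mu:A\bullet A\to A$, $\eta:\mathbf{I}\to A$ with $\mu\circ(\mu\bullet A)=\mu\circ(A\bullet\mu)$, $\omega_A\circ\mu\circ(\eta\bullet A)=\mathrm{id}_{\mathbf{I}\bullet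 A}$ and $\omega_A\circ\mu\circ(A\bullet\eta)\circ\ell_A=\mathrm{id}_{\mathbf{I}\bullet A}$. A $\mathbb{J}$-monad $(\mathbb{M},\boldsymbol{\mu},\omega,\boldsymbol{\nu};\mathbb{J})$, for an endofunctor $\mathbb{J}$, consists of an endofunctor $\mathbb{M}$ and natural transformations $\boldsymbol{\mu}:\mathbb{M}\mathbb{M}\to\mathbb{M}$, $\omega:\mathrm{Id}\to\mathbb{J}$, $\boldsymbol{\nu}:\mathbb{J}\to\mathbb{M}$ with, for all $X$, $\boldsymbol{\mu}_X\circ\mathbb{M}(\boldsymbol{\mu}_X)=\boldsymbol{\mu}_X\circ\boldsymbol{\mu}_{\mathbb{M}(X)}$, $\omega_{\mathbb{M}(X)}\circ\boldsymbol{\mu}_X\circ\boldsymbol{\nu}_{\mathbb{M}(X)}=\mathrm{id}_{\mathbb{J}\mathbb{M}(X)}$ and $\mathbb{M}(\omega_X)\circ\boldsymbol{\mu}_X\circ\mathbb{M}(\boldsymbol{\nu}_X)=\mathrm{id}_{\mathbb{M}\mathbb{J}(X)}$. In the claim, $\omega$ is always the fixed natural transformation belonging to the semiunit $\mathbf{I}$. An object $G$ of a cocomplete category is a regular generator if for every object $X$ the canonical morphism $\coprod_{f\in\mathrm{Hom}(G,X)}G\to X$ is a regular epimorphism (a coequalizer). *)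

theory Defs
  imports Main "HOL-Library.FuncSet" "HOL-Library.Equipollence"
begin

section \<open>Categories, functors, natural transformations\<close>

record ('o, 'm) category_data =
  Obj :: "'o set"
  Arr :: "'m set"
  Dom :: "'m \<Rightarrow> 'o"
  Cod :: "'m \<Rightarrow> 'o"
  Ide :: "'o \<Rightarrow> 'm"
  Cmp :: "'m \<Rightarrow> 'm \<Rightarrow> 'm"  (infixr \<open>\<cdot>\<index>\<close> 55)

definition hom :: "('o, 'm, 'x) category_data_scheme \<Rightarrow> 'o \<Rightarrow> 'o \<Rightarrow> 'm set" where
  "hom C X Y = {f \<in> Arr C. Dom C f = X \<and> Cod C f = Y}"

locale category =
  fixes C :: "('o, 'm, 'x) category_data_scheme" (structure)
  assumes Dom_closed: "f \<in> Arr C \<Longrightarrow> Dom C f \<in> Obj C"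
    and Cod_closed: "f \<in> Arr C \<Longrightarrow> Cod C f \<in> Obj C"
    and Ide_hom: "X \<in> Obj C \<Longrightarrow> Ide C X \<in> hom C X X"
    and Cmp_hom: "\<lbrakk>f \<in> hom C X Y; g \<in> hom C Y Z\<rbrakk> \<Longrightarrow> g \<cdot> f \<in> hom C X Z"
    and Cmp_Ide: "f \<in> hom C X Y \<Longrightarrow> f \<cdot> Ide C X = f"
    and Ide_Cmp: "f \<in> hom C X Y \<Longrightarrow> Ide C Y \<cdot> f = f"
    and Cmp_assoc: "\<lbrakk>f \<in> hom C W X; g \<in> hom C X Y; h \<in> hom C Y Z\<rbrakk>
                      \<Longrightarrow> (h \<cdot> g) \<cdot> f = h \<cdot> (g \<cdot> f)"

definition inverse_arrows :: "('o, 'm, 'x) category_data_scheme \<Rightarrow> 'm \<Rightarrow> 'm \<Rightarrow> bool" where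
  "inverse_arrows C f g \<longleftrightarrow>
     f \<in> Arr C \<and> g \<in> hom C (Cod C f) (Dom C f) \<and>
     g \<cdot>\<^bsub>C\<^esub> f = Ide C (Dom C f) \<and> f \<cdot>\<^bsub>C\<^esub> g = Ide C (Cod C f)"

definition iso :: "('o, 'm, 'x) category_data_scheme \<Rightarrow> 'm \<Rightarrow> bool" where
  "iso C f \<longleftrightarrow> (\<exists>g. inverse_arrows C f g)"

definition inv_arr :: "('o, 'm, 'x) category_data_scheme \<Rightarrow> 'm \<Rightarrow> 'm" where
  "inv_arr C f = (THE g. inverse_arrows C f g)"

record ('o, 'm, 'p, 'n) functor_data =
  obj_map :: "'o \<Rightarrow> 'p"
  arr_map :: "'m \<Rightarrow> 'n"

definition is_functor ::
  "('o, 'm, 'x) category_data_scheme \<Rightarrow> ('p, 'n, 'y) category_data_scheme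
    \<Rightarrow> ('o, 'm, 'p, 'n) functor_data \<Rightarrow> bool" where
  "is_functor C D F \<longleftrightarrow>
     (\<forall>X \<in> Obj C. obj_map F X \<in> Obj D) \<and>
     (\<forall>X Y. \<forall>f \<in> hom C X Y. arr_map F f \<in> hom D (obj_map F X) (obj_map F Y)) \<and>
     (\<forall>X \<in> Obj C. arr_map F (Ide C X) = Ide D (obj_map F X)) \<and>
     (\<forall>X Y Z. \<forall>f \<in> hom C X Y. \<forall>g \<in> hom C Y Z.
        arr_map F (g \<cdot>\<^bsub>C\<^esub> f) = arr_map F g \<cdot>\<^bsub>D\<^esub> arr_map F f)"

definition id_functor :: "('o, 'm, 'o, 'm) functor_data" where
  "id_functor = \<lparr>obj_map = (\<lambda>X. X), arr_map = (\<lambda>f. f)\<rparr>"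

definition comp_functor ::
  "('p, 'n, 'q, 'k) functor_data \<Rightarrow> ('o, 'm, 'p, 'n) functor_data
    \<Rightarrow> ('o, 'm, 'q, 'k) functor_data"  (infixr \<open>\<circ>\<^sub>F\<close> 55) where
  "G \<circ>\<^sub>F F = \<lparr>obj_map = obj_map G \<circ> obj_map F, arr_map = arr_map G \<circ> arr_map F\<rparr>"

definition natural_transformation ::
  "('o, 'm, 'x) category_data_scheme \<Rightarrow> ('p, 'n, 'y) category_data_scheme
    \<Rightarrow> ('o, 'm, 'p, 'n) functor_data \<Rightarrow> ('o, 'm, 'p, 'n) functor_data \<Rightarrow> ('o \<Rightarrow> 'n) \<Rightarrow> bool" where
  "natural_transformation C D F G \<tau> \<longleftrightarrow>
     (\<forall>X \<in> Obj C. \<tau> X \<in> hom D (obj_map F X) (obj_map G X)) \<and>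
     (\<forall>X Y. \<forall>f \<in> hom C X Y. \<tau> Y \<cdot>\<^bsub>D\<^esub> arr_map F f = arr_map G f \<cdot>\<^bsub>D\<^esub> \<tau> X)"

definition natural_isomorphism ::
  "('o, 'm, 'x) category_data_scheme \<Rightarrow> ('p, 'n, 'y) category_data_scheme
    \<Rightarrow> ('o, 'm, 'p, 'n) functor_data \<Rightarrow> ('o, 'm, 'p, 'n) functor_data \<Rightarrow> ('o \<Rightarrow> 'n) \<Rightarrow> bool" where
  "natural_isomorphism C D F G \<tau> \<longleftrightarrow>
     natural_transformation C D F G \<tau> \<and> (\<forall>X \<in> Obj C. iso D (\<tau> X))"

definition product_category ::
  "('o, 'm, 'x) category_data_scheme \<Rightarrow> ('p, 'n, 'y) category_data_scheme
    \<Rightarrow> ('o \<times> 'p, 'm \<times> 'n) category_data"  (infixr \<open>\<times>\<^sub>C\<close> 80) where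
  "C \<times>\<^sub>C D =
     \<lparr>Obj = Obj C \<times> Obj D,
      Arr = Arr C \<times> Arr D,
      Dom = map_prod (Dom C) (Dom D),
      Cod = map_prod (Cod C) (Cod D),
      Ide = map_prod (Ide C) (Ide D),
      Cmp = (\<lambda>(g, g') (f, f'). (g \<cdot>\<^bsub>C\<^esub> f, g' \<cdot>\<^bsub>D\<^esub> f'))\<rparr>"


section \<open>Colimits and regular generators\<close>

definition is_cocone ::
  "('j, 'k, 'y) category_data_scheme \<Rightarrow> ('o, 'm, 'x) category_data_scheme
    \<Rightarrow> ('j, 'k, 'o, 'm) functor_data \<Rightarrow> 'o \<Rightarrow> ('j \<Rightarrow> 'm) \<Rightarrow> bool" where
  "is_cocone J C D L \<iota> \<longleftrightarrow>
     L \<in> Obj C \<and>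
     (\<forall>j \<in> Obj J. \<iota> j \<in> hom C (obj_map D j) L) \<and>
     (\<forall>i j. \<forall>u \<in> hom J i j. \<iota> j \<cdot>\<^bsub>C\<^esub> arr_map D u = \<iota> i)"

definition is_colimit ::
  "('j, 'k, 'y) category_data_scheme \<Rightarrow> ('o, 'm, 'x) category_data_scheme
    \<Rightarrow> ('j, 'k, 'o, 'm) functor_data \<Rightarrow> 'o \<Rightarrow> ('j \<Rightarrow> 'm) \<Rightarrow> bool" where
  "is_colimit J C D L \<iota> \<longleftrightarrow>
     is_cocone J C D L \<iota> \<and>
     (\<forall>K \<kappa>. is_cocone J C D K \<kappa> \<longrightarrow>
        (\<exists>!h. h \<in> hom C L K \<and> (\<forall>j \<in> Obj J. h \<cdot>\<^bsub>C\<^esub> \<iota> j = \<kappa> j)))"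

text \<open>
  Smallness is relative to a universe, represented by an (infinite) type \<open>'u\<close>: a set is small
  if its cardinality is strictly less than that of \<open>'u\<close>.  If \<open>'u\<close> has inaccessible cardinality,
  these are the sets equipotent to a member of the corresponding Grothendieck universe; if \<open>'u\<close> is
  the class of all sets, this is von Neumann's limitation of size.  Fixing \<open>'u\<close> independently of
  the type of arrows is essential: a category that has all colimits of the size of its own set of
  arrows is a preorder.  Up to isomorphism every small category has its objects and arrows in
  \<open>'u\<close>, and its objects form a small set as soon as its arrows do.
\<close>

definition small :: "'u itself \<Rightarrow> 'a set \<Rightarrow> bool" where
  "small _ A \<longleftrightarrow> A \<prec> (UNIV :: 'u set)"

definition small_category :: "('u, 'u) category_data \<Rightarrow> bool" where
  "small_category J \<longleftrightarrow> category J \<and> small TYPE('u) (Arr J)"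

definition locally_small :: "'u itself \<Rightarrow> ('o, 'm, 'x) category_data_scheme \<Rightarrow> bool" where
  "locally_small U C \<longleftrightarrow> (\<forall>X \<in> Obj C. \<forall>Y \<in> Obj C. small U (hom C X Y))"

definition cocomplete :: "'u itself \<Rightarrow> ('o, 'm, 'x) category_data_scheme \<Rightarrow> bool" where
  "cocomplete _ C \<longleftrightarrow>
     (\<forall>(J :: ('u, 'u) category_data) D. small_category J \<and> is_functor J C D \<longrightarrow>
        (\<exists>L \<iota>. is_colimit J C D L \<iota>))"

definition preserves_colimits ::
  "'u itself \<Rightarrow> ('o, 'm, 'x) category_data_scheme \<Rightarrow> ('p, 'n, 'y) category_data_scheme
    \<Rightarrow> ('o, 'm, 'p, 'n) functor_data \<Rightarrow> bool" where
  "preserves_colimits _ C E F \<longleftrightarrow>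
     (\<forall>(J :: ('u, 'u) category_data) D L \<iota>.
        small_category J \<and> is_functor J C D \<and> is_colimit J C D L \<iota> \<longrightarrow>
        is_colimit J E (F \<circ>\<^sub>F D) (obj_map F L) (\<lambda>j. arr_map F (\<iota> j)))"

definition discrete_category :: "'i set \<Rightarrow> ('i, 'i) category_data" where
  "discrete_category S =
     \<lparr>Obj = S, Arr = S, Dom = (\<lambda>i. i), Cod = (\<lambda>i. i), Ide = (\<lambda>i. i), Cmp = (\<lambda>j i. i)\<rparr>"

definition is_coproduct ::
  "('o, 'm, 'x) category_data_scheme \<Rightarrow> 'i set \<Rightarrow> ('i \<Rightarrow> 'o) \<Rightarrow> 'o \<Rightarrow> ('i \<Rightarrow> 'm) \<Rightarrow> bool" where
  "is_coproduct C S X P \<iota> \<longleftrightarrow>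
     is_colimit (discrete_category S) C \<lparr>obj_map = X, arr_map = (\<lambda>i. Ide C (X i))\<rparr> P \<iota>"

definition is_coequalizer ::
  "('o, 'm, 'x) category_data_scheme \<Rightarrow> 'm \<Rightarrow> 'm \<Rightarrow> 'm \<Rightarrow> bool" where
  "is_coequalizer C f g e \<longleftrightarrow>
     f \<in> Arr C \<and> g \<in> hom C (Dom C f) (Cod C f) \<and>
     e \<in> Arr C \<and> Dom C e = Cod C f \<and> e \<cdot>\<^bsub>C\<^esub> f = e \<cdot>\<^bsub>C\<^esub> g \<and>
     (\<forall>Z. \<forall>h \<in> hom C (Cod C f) Z. h \<cdot>\<^bsub>C\<^esub> f = h \<cdot>\<^bsub>C\<^esub> g \<longrightarrow>
        (\<exists>!k. k \<in> hom C (Cod C e) Z \<and> k \<cdot>\<^bsub>C\<^esub> e = h))"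

definition regular_epi :: "('o, 'm, 'x) category_data_scheme \<Rightarrow> 'm \<Rightarrow> bool" where
  "regular_epi C e \<longleftrightarrow> (\<exists>f g. is_coequalizer C f g e)"

text \<open>
  The coproduct of copies of \<open>G\<close> indexed by \<open>hom C G X\<close> is unique up to isomorphism (and exists
  if \<open>C\<close> is cocomplete and locally small), so it does not matter which one is used; \<open>e\<close> is the
  canonical morphism, whose component at the index \<open>f\<close> is \<open>f\<close> itself.
\<close>

definition regular_generator :: "('o, 'm, 'x) category_data_scheme \<Rightarrow> 'o \<Rightarrow> bool" where
  "regular_generator C G \<longleftrightarrow>
     G \<in> Obj C \<and>
     (\<forall>X \<in> Obj C. \<exists>P \<iota> e.
        is_coproduct C (hom C G X) (\<lambda>_. G) P \<iota> \<and>
        e \<in> hom C P X \<and> (\<forall>f \<in> hom C G X. e \<cdot>\<^bsub>C\<^esub> \<iota> f = f) \<and>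
        regular_epi C e)"


section \<open>Semiunital semimonoidal categories\<close>

record ('o, 'm) semimonoidal_data = "('o, 'm) category_data" +
  tensor_obj :: "'o \<Rightarrow> 'o \<Rightarrow> 'o"  (infixr \<open>\<odot>\<index>\<close> 70)
  tensor_arr :: "'m \<Rightarrow> 'm \<Rightarrow> 'm"  (infixr \<open>\<bullet>\<index>\<close> 70)
  assoc :: "'o \<Rightarrow> 'o \<Rightarrow> 'o \<Rightarrow> 'm"  (\<open>\<gamma>\<index>\<close>)

definition tensor_functor ::
  "('o, 'm, 'x) semimonoidal_data_scheme \<Rightarrow> ('o \<times> 'o, 'm \<times> 'm, 'o, 'm) functor_data" where
  "tensor_functor V =
     \<lparr>obj_map = (\<lambda>(X, Y). X \<odot>\<^bsub>V\<^esub> Y), arr_map = (\<lambda>(f, g). f \<bullet>\<^bsub>V\<^esub> g)\<rparr>"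

definition left_tensor ::
  "('o, 'm, 'x) semimonoidal_data_scheme \<Rightarrow> 'o \<Rightarrow> ('o, 'm, 'o, 'm) functor_data" where
  "left_tensor V A =
     \<lparr>obj_map = (\<lambda>X. A \<odot>\<^bsub>V\<^esub> X), arr_map = (\<lambda>f. Ide V A \<bullet>\<^bsub>V\<^esub> f)\<rparr>"

definition right_tensor ::
  "('o, 'm, 'x) semimonoidal_data_scheme \<Rightarrow> 'o \<Rightarrow> ('o, 'm, 'o, 'm) functor_data" where
  "right_tensor V A =
     \<lparr>obj_map = (\<lambda>X. X \<odot>\<^bsub>V\<^esub> A), arr_map = (\<lambda>f. f \<bullet>\<^bsub>V\<^esub> Ide V A)\<rparr>"

locale semimonoidal_category = category V
  for V :: "('o, 'm, 'x) semimonoidal_data_scheme" (structure) +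
  assumes tensor_functor: "is_functor (V \<times>\<^sub>C V) V (tensor_functor V)"
    and assoc_natural_iso:
      "natural_isomorphism ((V \<times>\<^sub>C V) \<times>\<^sub>C V) V
         \<lparr>obj_map = (\<lambda>((X, Y), Z). (X \<odot> Y) \<odot> Z), arr_map = (\<lambda>((f, g), h). (f \<bullet> g) \<bullet> h)\<rparr>
         \<lparr>obj_map = (\<lambda>((X, Y), Z). X \<odot> (Y \<odot> Z)), arr_map = (\<lambda>((f, g), h). f \<bullet> (g \<bullet> h))\<rparr>
         (\<lambda>((X, Y), Z). \<gamma> X Y Z)"
    and pentagon:
      "\<lbrakk>W \<in> Obj V; X \<in> Obj V; Y \<in> Obj V; Z \<in> Obj V\<rbrakk> \<Longrightarrow>
         \<gamma> W X (Y \<odot> Z) \<cdot> \<gamma> (W \<odot> X) Y Z =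
         (Ide V W \<bullet> \<gamma> X Y Z) \<cdot> \<gamma> W (X \<odot> Y) Z \<cdot> (\<gamma> W X Y \<bullet> Ide V Z)"

record ('o, 'm) semiunital_data = "('o, 'm) semimonoidal_data" +
  semiunit :: "'o"  (\<open>\<I>\<index>\<close>)
  omega :: "'o \<Rightarrow> 'm"  (\<open>\<omega>\<index>\<close>)
  ell :: "'o \<Rightarrow> 'm"  (\<open>\<ell>\<index>\<close>)

definition wp :: "('o, 'm, 'x) semiunital_data_scheme \<Rightarrow> 'o \<Rightarrow> 'm"  (\<open>\<wp>\<index>\<close>) where
  "wp V X = inv_arr V (ell V X)"

locale semiunital_semimonoidal_category = semimonoidal_category V
  for V :: "('o, 'm, 'x) semiunital_data_scheme" (structure) +
  assumes semiunit_Obj: "\<I> \<in> Obj V"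
    and omega_natural: "natural_transformation V V id_functor (left_tensor V \<I>) \<omega>"
    and ell_natural_iso: "natural_isomorphism V V (left_tensor V \<I>) (right_tensor V \<I>) \<ell>"
    and ell_semiunit: "\<ell> \<I> = \<wp> \<I>"
    and ell_tensor:
      "\<lbrakk>X \<in> Obj V; Y \<in> Obj V\<rbrakk> \<Longrightarrow>
         \<gamma> X Y \<I> \<cdot> \<ell> (X \<odot> Y) \<cdot> \<gamma> \<I> X Y =
         (Ide V X \<bullet> \<ell> Y) \<cdot> \<gamma> X \<I> Y \<cdot> (\<ell> X \<bullet> Ide V Y)"
    and omega_tensor_left:
      "\<lbrakk>X \<in> Obj V; Y \<in> Obj V\<rbrakk> \<Longrightarrow>
         \<omega> (X \<odot> Y) = \<gamma> \<I> X Y \<cdot> (\<omega> X \<bullet> Ide V Y)"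
    and omega_tensor_right:
      "\<lbrakk>X \<in> Obj V; Y \<in> Obj V\<rbrakk> \<Longrightarrow>
         \<omega> (X \<odot> Y) =
         \<gamma> \<I> X Y \<cdot> (\<wp> X \<bullet> Ide V Y) \<cdot> inv_arr V (\<gamma> X \<I> Y) \<cdot> (Ide V X \<bullet> \<omega> Y)"

definition firm :: "('o, 'm, 'x) semiunital_data_scheme \<Rightarrow> 'o \<Rightarrow> bool" where
  "firm V X \<longleftrightarrow> X \<in> Obj V \<and> iso V (omega V X)"


section \<open>Semimonoids and J-monads\<close>

definition semimonoid_structures ::
  "('o, 'm, 'x) semiunital_data_scheme \<Rightarrow> 'o \<Rightarrow> ('m \<times> 'm) set" where
  "semimonoid_structures V A =
     {(\<mu>, \<eta>).
        \<mu> \<in> hom V (A \<odot>\<^bsub>V\<^esub> A) A \<and> \<eta> \<in> hom V \<I>\<^bsub>V\<^esub> A \<and>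
        \<mu> \<cdot>\<^bsub>V\<^esub> (\<mu> \<bullet>\<^bsub>V\<^esub> Ide V A) = \<mu> \<cdot>\<^bsub>V\<^esub> (Ide V A \<bullet>\<^bsub>V\<^esub> \<mu>) \<cdot>\<^bsub>V\<^esub> \<gamma>\<^bsub>V\<^esub> A A A \<and>
        \<omega>\<^bsub>V\<^esub> A \<cdot>\<^bsub>V\<^esub> \<mu> \<cdot>\<^bsub>V\<^esub> (\<eta> \<bullet>\<^bsub>V\<^esub> Ide V A) = Ide V (\<I>\<^bsub>V\<^esub> \<odot>\<^bsub>V\<^esub> A) \<and>
        \<omega>\<^bsub>V\<^esub> A \<cdot>\<^bsub>V\<^esub> \<mu> \<cdot>\<^bsub>V\<^esub> (Ide V A \<bullet>\<^bsub>V\<^esub> \<eta>) \<cdot>\<^bsub>V\<^esub> \<ell>\<^bsub>V\<^esub> A = Ide V (\<I>\<^bsub>V\<^esub> \<odot>\<^bsub>V\<^esub> A)}"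

definition J_monad ::
  "('o, 'm, 'x) category_data_scheme \<Rightarrow> ('o, 'm, 'o, 'm) functor_data \<Rightarrow> ('o \<Rightarrow> 'm)
    \<Rightarrow> ('o \<Rightarrow> 'm) \<Rightarrow> ('o \<Rightarrow> 'm) \<Rightarrow> ('o, 'm, 'o, 'm) functor_data \<Rightarrow> bool" where
  "J_monad C M \<mu> w \<nu> J \<longleftrightarrow>
     is_functor C C J \<and> is_functor C C M \<and>
     natural_transformation C C (M \<circ>\<^sub>F M) M \<mu> \<and>
     natural_transformation C C id_functor J w \<and>
     natural_transformation C C J M \<nu> \<and>
     (\<forall>X \<in> Obj C.
        \<mu> X \<cdot>\<^bsub>C\<^esub> arr_map M (\<mu> X) = \<mu> X \<cdot>\<^bsub>C\<^esub> \<mu> (obj_map M X) \<and>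
        w (obj_map M X) \<cdot>\<^bsub>C\<^esub> \<mu> X \<cdot>\<^bsub>C\<^esub> \<nu> (obj_map M X) = Ide C (obj_map J (obj_map M X)) \<and>
        arr_map M (w X) \<cdot>\<^bsub>C\<^esub> \<mu> X \<cdot>\<^bsub>C\<^esub> arr_map M (\<nu> X) = Ide C (obj_map M (obj_map J X)))"

text \<open>
  The structures \<open>(\<mu>, \<nu>)\<close> on \<open>M\<close> for given \<open>J\<close> and \<open>w\<close>.  Families indexed by the
  objects are taken to be \<^const>\<open>undefined\<close> outside \<^term>\<open>Obj C\<close>, so that distinct
  functions represent distinct natural transformations.
\<close>

definition J_monad_structures ::
  "('o, 'm, 'x) category_data_scheme \<Rightarrow> ('o, 'm, 'o, 'm) functor_data \<Rightarrow> ('o \<Rightarrow> 'm)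
    \<Rightarrow> ('o, 'm, 'o, 'm) functor_data \<Rightarrow> (('o \<Rightarrow> 'm) \<times> ('o \<Rightarrow> 'm)) set" where
  "J_monad_structures C J w M =
     {(\<mu>, \<nu>). \<mu> \<in> extensional (Obj C) \<and> \<nu> \<in> extensional (Obj C) \<and> J_monad C M \<mu> w \<nu> J}"

text \<open>
  The two sides of the correspondence.  \<open>\<J>\<close> is realised as \<^term>\<open>left_tensor V (semiunit V)\<close>;
  its identification with \<^term>\<open>right_tensor V (semiunit V)\<close> is \<open>\<ell>\<close>, which therefore enters
  the unit of the monad on \<^term>\<open>right_tensor V A\<close>.
\<close>

definition right_monad_of ::
  "('o, 'm, 'x) semiunital_data_scheme \<Rightarrow> 'o \<Rightarrow> 'm \<times> 'm \<Rightarrow> ('o \<Rightarrow> 'm) \<times> ('o \<Rightarrow> 'm)" where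
  "right_monad_of V A = (\<lambda>(\<mu>, \<eta>).
     (\<lambda>X\<in>Obj V. (Ide V X \<bullet>\<^bsub>V\<^esub> \<mu>) \<cdot>\<^bsub>V\<^esub> \<gamma>\<^bsub>V\<^esub> X A A,
      \<lambda>X\<in>Obj V. (Ide V X \<bullet>\<^bsub>V\<^esub> \<eta>) \<cdot>\<^bsub>V\<^esub> \<ell>\<^bsub>V\<^esub> X))"

definition left_monad_of ::
  "('o, 'm, 'x) semiunital_data_scheme \<Rightarrow> 'o \<Rightarrow> 'm \<times> 'm \<Rightarrow> ('o \<Rightarrow> 'm) \<times> ('o \<Rightarrow> 'm)" where
  "left_monad_of V A = (\<lambda>(\<mu>, \<eta>).
     (\<lambda>X\<in>Obj V. (\<mu> \<bullet>\<^bsub>V\<^esub> Ide V X) \<cdot>\<^bsub>V\<^esub> inv_arr V (\<gamma>\<^bsub>V\<^esub> A A X),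
      \<lambda>X\<in>Obj V. \<eta> \<bullet>\<^bsub>V\<^esub> Ide V X))"

end

theory Submission
  imports Defs
begin

text \<open>
  A semimonoid structure \<open>(\<mu>, \<eta>)\<close> on \<open>A\<close> induces transformations by whiskering, and conversely a
  monad structure is recovered from its components at \<open>\<I>\<close>.  Two observations make this work.

  First, the axioms relating \<open>\<omega>\<close>, \<open>\<ell>\<close> and products say that \<open>X \<bullet> \<omega> Y\<close> and \<open>\<omega> X \<bullet> Y\<close> differ only by
  canonical isomorphisms (\<open>omega_balanced\<close>).  With the pentagon and the product rule for \<open>\<ell>\<close> it
  follows that each of the three laws of a \<open>\<J>\<close>-monad at \<open>X\<close> is, up to conjugation by isomorphisms,
  one of the three laws of a semimonoid tensored with \<open>X\<close>.  So a semimonoid gives a monad.  It also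
  follows that a product with a firm factor is firm.  Between firm objects naturality of \<open>\<omega>\<close>
  identifies \<open>\<I> \<bullet> g\<close> with \<open>g\<close>, so \<open>\<I> \<bullet> -\<close> is full and faithful there (\<open>semiunit_tensor_faithful\<close>,
  \<open>semiunit_tensor_full\<close>), and so is \<open>- \<bullet> \<I>\<close> by way of \<open>\<ell>\<close>.  As \<open>\<I>\<close>, \<open>A\<close> and \<open>A \<bullet> A\<close> are firm, the
  components of a monad structure at \<open>\<I>\<close> determine a unique pair \<open>(\<mu>, \<eta>)\<close>, and the monad laws at
  \<open>\<I>\<close> make it a semimonoid.

  Secondly, the monad structure has to be the one induced by \<open>(\<mu>, \<eta>)\<close> at all objects, not just at
  \<open>\<I>\<close>.  Since \<open>\<I>\<close> is a regular generator, every object is a regular quotient of a coproduct of copies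
  of \<open>\<I>\<close>, and a functor preserving colimits preserves this presentation.  Hence transformations out of
  such a functor that agree at \<open>\<I>\<close> agree everywhere
  (\<open>natural_transformations_eq_if_eq_at_generator\<close>), which applies to the multiplications, whose
  source is the square of \<open>- \<bullet> A\<close> or of \<open>A \<bullet> -\<close>.  The units start at \<open>\<J>\<close>, about which nothing of the
  kind is known; but their composites with \<open>\<omega>\<close> start at the identity functor, and because \<open>\<I>\<close> and
  the targets are firm, these composites determine the units
  (\<open>transformations_from_J_eq_if_eq_at_semiunit\<close>).
\<close>

section \<open>Composition and inverses\<close>

context category
begin

lemma in_hom: "f \<in> hom C X Y \<longleftrightarrow> f \<in> Arr C \<and> Dom C f = X \<and> Cod C f = Y"
  by (auto simp: hom_def)

lemma Ide_typing [simp]: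
  assumes "X \<in> Obj C"
  shows "Ide C X \<in> Arr C" "Dom C (Ide C X) = X" "Cod C (Ide C X) = X"
  using Ide_hom[OF assms] by (auto simp: in_hom)

lemma Cmp_typing [simp]:
  assumes "f \<in> Arr C" "g \<in> Arr C" "Dom C g = Cod C f"
  shows "g \<cdot> f \<in> Arr C" "Dom C (g \<cdot> f) = Dom C f" "Cod C (g \<cdot> f) = Cod C g"
  using Cmp_hom[of f "Dom C f" "Cod C f" g "Cod C g"] assms by (auto simp: in_hom)

lemma Dom_Obj [simp]: "f \<in> Arr C \<Longrightarrow> Dom C f \<in> Obj C"
  by (rule Dom_closed)

lemma Cod_Obj [simp]: "f \<in> Arr C \<Longrightarrow> Cod C f \<in> Obj C"
  by (rule Cod_closed)

lemma Cmp_Ide_arr [simp]: "f \<in> Arr C \<Longrightarrow> Dom C f = X \<Longrightarrow> f \<cdot> Ide C X = f"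
  using Cmp_Ide[of f X "Cod C f"] by (auto simp: in_hom)

lemma Ide_Cmp_arr [simp]: "f \<in> Arr C \<Longrightarrow> Cod C f = X \<Longrightarrow> Ide C X \<cdot> f = f"
  using Ide_Cmp[of f "Dom C f" X] by (auto simp: in_hom)

lemma Cmp_assoc_arr [simp]:
  assumes "f \<in> Arr C" "g \<in> Arr C" "h \<in> Arr C" "Dom C g = Cod C f" "Dom C h = Cod C g"
  shows "(h \<cdot> g) \<cdot> f = h \<cdot> (g \<cdot> f)"
  using Cmp_assoc[of f "Dom C f" "Cod C f" g "Cod C g" h "Cod C h"] assms by (auto simp: in_hom)

lemma inverse_arrows_unique:
  assumes "inverse_arrows C f g" "inverse_arrows C f h"
  shows "g = h"
proof -
  have "(g \<cdot> f) \<cdot> h = g \<cdot> (f \<cdot> h)"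
    using assms by (intro Cmp_assoc_arr) (auto simp: inverse_arrows_def in_hom)
  then show ?thesis
    using assms by (auto simp: inverse_arrows_def in_hom)
qed

lemma inv_arr_eq: "inverse_arrows C f g \<Longrightarrow> inv_arr C f = g"
  unfolding inv_arr_def by (rule the_equality) (auto intro: inverse_arrows_unique)

lemma iso_inv_arr: "iso C f \<Longrightarrow> inverse_arrows C f (inv_arr C f)"
  using inv_arr_eq by (auto simp: iso_def)

lemma iso_arr [simp]: "iso C f \<Longrightarrow> f \<in> Arr C"
  by (auto simp: iso_def inverse_arrows_def)

lemma inv_arr_typing [simp]:
  assumes "iso C f"
  shows "inv_arr C f \<in> Arr C" "Dom C (inv_arr C f) = Cod C f" "Cod C (inv_arr C f) = Dom C f"
  using iso_inv_arr[OF assms] by (auto simp: inverse_arrows_def in_hom)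

lemma inv_arr_Cmp [simp]:
  assumes "iso C f"
  shows "inv_arr C f \<cdot> f = Ide C (Dom C f)" "f \<cdot> inv_arr C f = Ide C (Cod C f)"
  using iso_inv_arr[OF assms] by (auto simp: inverse_arrows_def)

lemma inv_arr_cancel [simp]:
  assumes "iso C f" "g \<in> Arr C"
  shows "Cod C g = Dom C f \<Longrightarrow> inv_arr C f \<cdot> (f \<cdot> g) = g"
    and "Cod C g = Cod C f \<Longrightarrow> f \<cdot> (inv_arr C f \<cdot> g) = g"
  using assms by (simp_all flip: Cmp_assoc_arr)

lemma isoI:
  assumes "f \<in> Arr C" "g \<in> Arr C" "Dom C g = Cod C f" "Cod C g = Dom C f"
    and "g \<cdot> f = Ide C (Dom C f)" "f \<cdot> g = Ide C (Cod C f)"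
  shows "iso C f"
  unfolding iso_def inverse_arrows_def in_hom using assms by blast

lemma iso_inv_iso [simp]: "iso C f \<Longrightarrow> iso C (inv_arr C f)"
  by (rule isoI[of _ f]) auto

lemma iso_Cmp [simp]:
  assumes "iso C f" "iso C g" "Dom C g = Cod C f"
  shows "iso C (g \<cdot> f)"
  by (rule isoI[of _ "inv_arr C f \<cdot> inv_arr C g"]) (use assms in auto)

lemma iso_monic:
  assumes "iso C k" "k \<cdot> f = k \<cdot> g" "f \<in> Arr C" "g \<in> Arr C" "Cod C f = Dom C k" "Cod C g = Dom C k"
  shows "f = g"
proof -
  have "inv_arr C k \<cdot> (k \<cdot> f) = inv_arr C k \<cdot> (k \<cdot> g)"
    by (simp only: assms(2))
  then show ?thesis
    by (simp only: inv_arr_cancel(1)[OF assms(1)] assms(3-6))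
qed

lemma iso_epic:
  assumes "iso C k" "f \<cdot> k = g \<cdot> k" "f \<in> Arr C" "g \<in> Arr C" "Dom C f = Cod C k" "Dom C g = Cod C k"
  shows "f = g"
proof -
  have "(f \<cdot> k) \<cdot> inv_arr C k = (g \<cdot> k) \<cdot> inv_arr C k"
    by (simp only: assms(2))
  then show ?thesis
    using assms(1,3-6) by simp
qed

text \<open>An endomorphism conjugate to an identity is an identity: every unit law of a \<open>\<J>\<close>-monad
  below is such a conjugate of a unit law of a semimonoid.\<close>

lemma conjugate_eq_Ide_iff:
  assumes "iso C k" "u \<in> Arr C" "Dom C u = Dom C k" "Cod C u = Dom C k"
  shows "k \<cdot> u \<cdot> inv_arr C k = Ide C (Cod C k) \<longleftrightarrow> u = Ide C (Dom C k)"
proof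
  assume "k \<cdot> u \<cdot> inv_arr C k = Ide C (Cod C k)"
  then have "inv_arr C k \<cdot> (k \<cdot> u \<cdot> inv_arr C k) \<cdot> k = inv_arr C k \<cdot> Ide C (Cod C k) \<cdot> k"
    by (simp only:)
  then show "u = Ide C (Dom C k)"
    using assms by simp
qed (use assms in simp)

end

section \<open>Whiskering and the semiunit\<close>

context semimonoidal_category
begin

lemma tensor_Obj [simp]: "X \<in> Obj V \<Longrightarrow> Y \<in> Obj V \<Longrightarrow> X \<odot> Y \<in> Obj V"
  using tensor_functor by (auto simp: is_functor_def tensor_functor_def product_category_def)

lemma tensor_typing [simp]:
  assumes "f \<in> Arr V" "g \<in> Arr V"
  shows "f \<bullet> g \<in> Arr V" "Dom V (f \<bullet> g) = Dom V f \<odot> Dom V g" "Cod V (f \<bullet> g) = Cod V f \<odot> Cod V g"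
proof -
  have "(f, g) \<in> hom (V \<times>\<^sub>C V) (Dom V f, Dom V g) (Cod V f, Cod V g)"
    using assms by (auto simp: hom_def product_category_def)
  then have "f \<bullet> g \<in> hom V (Dom V f \<odot> Dom V g) (Cod V f \<odot> Cod V g)"
    using tensor_functor unfolding is_functor_def by (fastforce simp: tensor_functor_def)
  then show "f \<bullet> g \<in> Arr V" "Dom V (f \<bullet> g) = Dom V f \<odot> Dom V g"
    "Cod V (f \<bullet> g) = Cod V f \<odot> Cod V g"
    by (auto simp: in_hom)
qed

lemma tensor_Ide [simp]:
  assumes "X \<in> Obj V" "Y \<in> Obj V"
  shows "Ide V X \<bullet> Ide V Y = Ide V (X \<odot> Y)"
  using tensor_functor assms by (auto simp: is_functor_def tensor_functor_def product_category_def)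

lemma interchange [simp]:
  assumes "f \<in> Arr V" "g \<in> Arr V" "Dom V g = Cod V f"
    and "f' \<in> Arr V" "g' \<in> Arr V" "Dom V g' = Cod V f'"
  shows "(g \<bullet> g') \<cdot> (f \<bullet> f') = (g \<cdot> f) \<bullet> (g' \<cdot> f')"
proof -
  have "(f, f') \<in> hom (V \<times>\<^sub>C V) (Dom V f, Dom V f') (Cod V f, Cod V f')"
    "(g, g') \<in> hom (V \<times>\<^sub>C V) (Cod V f, Cod V f') (Cod V g, Cod V g')"
    using assms by (auto simp: hom_def product_category_def)
  then have "arr_map (tensor_functor V) ((g, g') \<cdot>\<^bsub>V \<times>\<^sub>C V\<^esub> (f, f'))
      = arr_map (tensor_functor V) (g, g') \<cdot> arr_map (tensor_functor V) (f, f')"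
    using tensor_functor unfolding is_functor_def by blast
  then show ?thesis
    by (simp add: tensor_functor_def product_category_def)
qed

lemma interchange_tail [simp]:
  assumes "f \<in> Arr V" "g \<in> Arr V" "Dom V g = Cod V f"
    and "f' \<in> Arr V" "g' \<in> Arr V" "Dom V g' = Cod V f'"
    and "k \<in> Arr V" "Cod V k = Dom V f \<odot> Dom V f'"
  shows "(g \<bullet> g') \<cdot> (f \<bullet> f') \<cdot> k = ((g \<cdot> f) \<bullet> (g' \<cdot> f')) \<cdot> k"
proof -
  have "(g \<bullet> g') \<cdot> (f \<bullet> f') \<cdot> k = ((g \<bullet> g') \<cdot> (f \<bullet> f')) \<cdot> k"
    using assms by (intro Cmp_assoc_arr[symmetric]) auto
  then show ?thesis
    using assms by simp
qed

lemma iso_tensor [simp]: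
  assumes "iso V f" "iso V g"
  shows "iso V (f \<bullet> g)"
  by (rule isoI[of _ "inv_arr V f \<bullet> inv_arr V g"]) (use assms in auto)

lemma iso_Ide [simp]: "X \<in> Obj V \<Longrightarrow> iso V (Ide V X)"
  by (rule isoI[of _ "Ide V X"]) auto

lemma inv_arr_Ide [simp]: "X \<in> Obj V \<Longrightarrow> inv_arr V (Ide V X) = Ide V X"
  by (rule inv_arr_eq) (auto simp: inverse_arrows_def in_hom)

lemma inv_arr_tensor:
  assumes "iso V f" "iso V g"
  shows "inv_arr V (f \<bullet> g) = inv_arr V f \<bullet> inv_arr V g"
  by (rule inv_arr_eq) (use assms in \<open>auto simp: inverse_arrows_def in_hom\<close>)

lemma inv_arr_Cmp_distrib:
  assumes "iso V f" "iso V g" "Dom V g = Cod V f"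
  shows "inv_arr V (g \<cdot> f) = inv_arr V f \<cdot> inv_arr V g"
  by (rule inv_arr_eq) (use assms in \<open>auto simp: inverse_arrows_def in_hom\<close>)

lemma assoc_iso [simp]:
  assumes "X \<in> Obj V" "Y \<in> Obj V" "Z \<in> Obj V"
  shows "iso V (\<gamma> X Y Z)"
  using assoc_natural_iso assms by (auto simp: natural_isomorphism_def product_category_def)

lemma assoc_typing [simp]:
  assumes "X \<in> Obj V" "Y \<in> Obj V" "Z \<in> Obj V"
  shows "Dom V (\<gamma> X Y Z) = (X \<odot> Y) \<odot> Z" "Cod V (\<gamma> X Y Z) = X \<odot> (Y \<odot> Z)"
  using assoc_natural_iso assms
  by (auto simp: natural_isomorphism_def natural_transformation_def product_category_def in_hom)

lemma assoc_natural:
  assumes "f \<in> Arr V" "g \<in> Arr V" "h \<in> Arr V"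
  shows "\<gamma> (Cod V f) (Cod V g) (Cod V h) \<cdot> ((f \<bullet> g) \<bullet> h)
    = (f \<bullet> (g \<bullet> h)) \<cdot> \<gamma> (Dom V f) (Dom V g) (Dom V h)"
proof -
  have "((f, g), h) \<in> hom ((V \<times>\<^sub>C V) \<times>\<^sub>C V) ((Dom V f, Dom V g), Dom V h) ((Cod V f, Cod V g), Cod V h)"
    using assms by (auto simp: hom_def product_category_def)
  then show ?thesis
    using assoc_natural_iso unfolding natural_isomorphism_def natural_transformation_def
    by fastforce
qed

lemma inv_assoc_natural:
  assumes "f \<in> Arr V" "g \<in> Arr V" "h \<in> Arr V"
  shows "inv_arr V (\<gamma> (Cod V f) (Cod V g) (Cod V h)) \<cdot> (f \<bullet> (g \<bullet> h))
    = ((f \<bullet> g) \<bullet> h) \<cdot> inv_arr V (\<gamma> (Dom V f) (Dom V g) (Dom V h))"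
proof (rule iso_monic[of "\<gamma> (Cod V f) (Cod V g) (Cod V h)"])
  have "\<gamma> (Cod V f) (Cod V g) (Cod V h) \<cdot> ((f \<bullet> g) \<bullet> h) \<cdot> inv_arr V (\<gamma> (Dom V f) (Dom V g) (Dom V h))
    = (\<gamma> (Cod V f) (Cod V g) (Cod V h) \<cdot> ((f \<bullet> g) \<bullet> h)) \<cdot> inv_arr V (\<gamma> (Dom V f) (Dom V g) (Dom V h))"
    using assms by (intro Cmp_assoc_arr[symmetric]) auto
  then show "\<gamma> (Cod V f) (Cod V g) (Cod V h) \<cdot> inv_arr V (\<gamma> (Cod V f) (Cod V g) (Cod V h)) \<cdot> (f \<bullet> (g \<bullet> h))
    = \<gamma> (Cod V f) (Cod V g) (Cod V h) \<cdot> ((f \<bullet> g) \<bullet> h) \<cdot> inv_arr V (\<gamma> (Dom V f) (Dom V g) (Dom V h))"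
    using assms by (simp add: assoc_natural)
qed (use assms in auto)

lemma left_tensor_functor: "A \<in> Obj V \<Longrightarrow> is_functor V V (left_tensor V A)"
  by (auto simp: is_functor_def left_tensor_def in_hom)

lemma right_tensor_functor: "A \<in> Obj V \<Longrightarrow> is_functor V V (right_tensor V A)"
  by (auto simp: is_functor_def right_tensor_def in_hom)

end

context semiunital_semimonoidal_category
begin

lemma semiunit [simp]: "\<I> \<in> Obj V"
  by (rule semiunit_Obj)

lemma omega_typing [simp]:
  assumes "X \<in> Obj V"
  shows "\<omega> X \<in> Arr V" "Dom V (\<omega> X) = X" "Cod V (\<omega> X) = \<I> \<odot> X"
  using omega_natural assms
  by (auto simp: natural_transformation_def id_functor_def left_tensor_def in_hom)

lemma omega_nat: "f \<in> Arr V \<Longrightarrow> \<omega> (Cod V f) \<cdot> f = (Ide V \<I> \<bullet> f) \<cdot> \<omega> (Dom V f)"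
  using omega_natural
  by (auto simp: natural_transformation_def id_functor_def left_tensor_def in_hom)

lemma ell_iso [simp]: "X \<in> Obj V \<Longrightarrow> iso V (\<ell> X)"
  using ell_natural_iso by (auto simp: natural_isomorphism_def)

lemma ell_typing [simp]:
  assumes "X \<in> Obj V"
  shows "Dom V (\<ell> X) = \<I> \<odot> X" "Cod V (\<ell> X) = X \<odot> \<I>"
  using ell_natural_iso assms
  by (auto simp: natural_isomorphism_def natural_transformation_def left_tensor_def
      right_tensor_def in_hom)

lemma ell_nat: "f \<in> Arr V \<Longrightarrow> \<ell> (Cod V f) \<cdot> (Ide V \<I> \<bullet> f) = (f \<bullet> Ide V \<I>) \<cdot> \<ell> (Dom V f)"
  using ell_natural_iso
  by (auto simp: natural_isomorphism_def natural_transformation_def left_tensor_def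
      right_tensor_def in_hom)

text \<open>The two descriptions of \<open>\<omega>\<close> at a product agree, and the common factor \<open>\<gamma> \<I> X Y\<close> cancels:
  \<open>\<omega>\<close> may be moved across a product at the price of the isomorphism \<open>\<ell>\<close>.  Hence firmness of one
  factor makes the \<open>\<omega>\<close> of the other factor invertible after whiskering.\<close>

lemma omega_balanced:
  assumes [simp]: "X \<in> Obj V" "Y \<in> Obj V"
  shows "Ide V X \<bullet> \<omega> Y = \<gamma> X \<I> Y \<cdot> (\<ell> X \<bullet> Ide V Y) \<cdot> (\<omega> X \<bullet> Ide V Y)"
proof -
  have "\<omega> X \<bullet> Ide V Y = (\<wp> X \<bullet> Ide V Y) \<cdot> inv_arr V (\<gamma> X \<I> Y) \<cdot> (Ide V X \<bullet> \<omega> Y)"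
    by (rule iso_monic[of "\<gamma> \<I> X Y"])
      (use omega_tensor_left[of X Y] omega_tensor_right[of X Y] in \<open>auto simp: wp_def\<close>)
  then show ?thesis
    by (simp add: wp_def)
qed

end

section \<open>Monad laws as whiskered semimonoid laws\<close>

context semiunital_semimonoidal_category
begin

text \<open>Naturality of \<open>\<gamma>\<close> brings both sides into the form of a whiskered arrow precomposed with
  associativity isomorphisms.  The pentagon compares these; it leaves a common factor \<open>k\<close>, and the
  remaining \<open>X \<bullet> \<gamma> A A A\<close> is absorbed into the semimonoid law.\<close>

lemma right_associativity:
  assumes [simp]: "A \<in> Obj V" "X \<in> Obj V" "m \<in> Arr V" "Dom V m = A \<odot> A" "Cod V m = A"
  defines "mu \<equiv> \<lambda>X. (Ide V X \<bullet> m) \<cdot> \<gamma> X A A"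
  shows "mu X \<cdot> (mu X \<bullet> Ide V A) = mu X \<cdot> mu (X \<odot> A) \<longleftrightarrow>
    Ide V X \<bullet> (m \<cdot> (m \<bullet> Ide V A)) = Ide V X \<bullet> (m \<cdot> (Ide V A \<bullet> m) \<cdot> \<gamma> A A A)"
proof -
  define k where "k = \<gamma> X (A \<odot> A) A \<cdot> (\<gamma> X A A \<bullet> Ide V A)"
  have k: "iso V k" "Dom V k = ((X \<odot> A) \<odot> A) \<odot> A" "Cod V k = X \<odot> ((A \<odot> A) \<odot> A)"
    unfolding k_def by auto
  have nat1: "\<gamma> X A A \<cdot> ((Ide V X \<bullet> m) \<bullet> Ide V A) = (Ide V X \<bullet> (m \<bullet> Ide V A)) \<cdot> \<gamma> X (A \<odot> A) A"
    using assoc_natural[of "Ide V X" m "Ide V A"] by simp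
  have nat2: "\<gamma> X A A \<cdot> (Ide V (X \<odot> A) \<bullet> m) = (Ide V X \<bullet> (Ide V A \<bullet> m)) \<cdot> \<gamma> X A (A \<odot> A)"
    using assoc_natural[of "Ide V X" "Ide V A" m] by simp
  have "mu X \<cdot> (mu X \<bullet> Ide V A)
      = (Ide V X \<bullet> m) \<cdot> (\<gamma> X A A \<cdot> ((Ide V X \<bullet> m) \<bullet> Ide V A)) \<cdot> (\<gamma> X A A \<bullet> Ide V A)"
    by (simp add: mu_def)
  also have "\<dots> = (Ide V X \<bullet> (m \<cdot> (m \<bullet> Ide V A))) \<cdot> k"
    unfolding nat1 by (simp add: k_def)
  finally have l: "mu X \<cdot> (mu X \<bullet> Ide V A) = (Ide V X \<bullet> (m \<cdot> (m \<bullet> Ide V A))) \<cdot> k" .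
  have "mu X \<cdot> mu (X \<odot> A)
      = (Ide V X \<bullet> m) \<cdot> (\<gamma> X A A \<cdot> (Ide V (X \<odot> A) \<bullet> m)) \<cdot> \<gamma> (X \<odot> A) A A"
    by (simp add: mu_def)
  also have "\<dots> = (Ide V X \<bullet> (m \<cdot> (Ide V A \<bullet> m))) \<cdot> (\<gamma> X A (A \<odot> A) \<cdot> \<gamma> (X \<odot> A) A A)"
    unfolding nat2 by simp
  also have "\<dots> = (Ide V X \<bullet> (m \<cdot> (Ide V A \<bullet> m) \<cdot> \<gamma> A A A)) \<cdot> k"
    by (simp add: pentagon k_def)
  finally have r: "mu X \<cdot> mu (X \<odot> A) = (Ide V X \<bullet> (m \<cdot> (Ide V A \<bullet> m) \<cdot> \<gamma> A A A)) \<cdot> k" .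
  show ?thesis
    unfolding l r by (auto dest: iso_epic[OF k(1)] simp: k)
qed

text \<open>The axiom for \<open>\<ell>\<close> at \<open>X \<bullet> A\<close> carries \<open>\<I>\<close> across \<open>X\<close> by precisely the inverse of the
  isomorphism \<open>k\<close> by which \<open>\<omega>\<close> at \<open>X \<bullet> A\<close> differs from \<open>X \<bullet> \<omega> A\<close>; this is why the unit law appears
  conjugated by \<open>k\<close>.\<close>

lemma right_unit_outer:
  assumes [simp]: "A \<in> Obj V" "X \<in> Obj V" "m \<in> Arr V" "Dom V m = A \<odot> A" "Cod V m = A"
    "e \<in> Arr V" "Dom V e = \<I>" "Cod V e = A"
  shows "\<omega> (X \<odot> A) \<cdot> ((Ide V X \<bullet> m) \<cdot> \<gamma> X A A) \<cdot> ((Ide V (X \<odot> A) \<bullet> e) \<cdot> \<ell> (X \<odot> A))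
      = Ide V (\<I> \<odot> (X \<odot> A)) \<longleftrightarrow>
    Ide V X \<bullet> (\<omega> A \<cdot> m \<cdot> (Ide V A \<bullet> e) \<cdot> \<ell> A) = Ide V (X \<odot> (\<I> \<odot> A))"
proof -
  define k where "k = \<gamma> \<I> X A \<cdot> (\<wp> X \<bullet> Ide V A) \<cdot> inv_arr V (\<gamma> X \<I> A)"
  have k: "iso V k" "Dom V k = X \<odot> (\<I> \<odot> A)" "Cod V k = \<I> \<odot> (X \<odot> A)"
    unfolding k_def wp_def by auto
  have inv_k: "inv_arr V k = \<gamma> X \<I> A \<cdot> (\<ell> X \<bullet> Ide V A) \<cdot> inv_arr V (\<gamma> \<I> X A)"
    by (rule inv_arr_eq) (auto simp: k_def wp_def inverse_arrows_def in_hom)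
  have om: "\<omega> (X \<odot> A) = k \<cdot> (Ide V X \<bullet> \<omega> A)"
    by (simp add: omega_tensor_right k_def wp_def)
  have nat: "\<gamma> X A A \<cdot> (Ide V (X \<odot> A) \<bullet> e) = (Ide V X \<bullet> (Ide V A \<bullet> e)) \<cdot> \<gamma> X A \<I>"
    using assoc_natural[of "Ide V X" "Ide V A" e] by simp
  have "\<gamma> X A \<I> \<cdot> \<ell> (X \<odot> A) = (\<gamma> X A \<I> \<cdot> \<ell> (X \<odot> A) \<cdot> \<gamma> \<I> X A) \<cdot> inv_arr V (\<gamma> \<I> X A)"
    by simp
  also have "\<dots> = (Ide V X \<bullet> \<ell> A) \<cdot> inv_arr V k"
    unfolding ell_tensor[OF assms(2,1)] by (simp add: inv_k)
  finally have ell: "\<gamma> X A \<I> \<cdot> \<ell> (X \<odot> A) = (Ide V X \<bullet> \<ell> A) \<cdot> inv_arr V k" .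
  have "\<omega> (X \<odot> A) \<cdot> ((Ide V X \<bullet> m) \<cdot> \<gamma> X A A) \<cdot> ((Ide V (X \<odot> A) \<bullet> e) \<cdot> \<ell> (X \<odot> A))
      = \<omega> (X \<odot> A) \<cdot> (Ide V X \<bullet> m) \<cdot> (\<gamma> X A A \<cdot> (Ide V (X \<odot> A) \<bullet> e)) \<cdot> \<ell> (X \<odot> A)"
    by simp
  also have "\<dots> = k \<cdot> (Ide V X \<bullet> (\<omega> A \<cdot> m \<cdot> (Ide V A \<bullet> e))) \<cdot> (\<gamma> X A \<I> \<cdot> \<ell> (X \<odot> A))"
    unfolding nat om by (simp add: k)
  also have "\<dots> = k \<cdot> (Ide V X \<bullet> (\<omega> A \<cdot> m \<cdot> (Ide V A \<bullet> e) \<cdot> \<ell> A)) \<cdot> inv_arr V k"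
    unfolding ell by (simp add: k)
  finally show ?thesis
    using conjugate_eq_Ide_iff[OF k(1), of "Ide V X \<bullet> (\<omega> A \<cdot> m \<cdot> (Ide V A \<bullet> e) \<cdot> \<ell> A)"]
    by (simp add: k)
qed

lemma right_unit_inner:
  assumes [simp]: "A \<in> Obj V" "X \<in> Obj V" "m \<in> Arr V" "Dom V m = A \<odot> A" "Cod V m = A"
    "e \<in> Arr V" "Dom V e = \<I>" "Cod V e = A"
  shows "(\<omega> X \<bullet> Ide V A) \<cdot> ((Ide V X \<bullet> m) \<cdot> \<gamma> X A A) \<cdot> (((Ide V X \<bullet> e) \<cdot> \<ell> X) \<bullet> Ide V A)
      = Ide V ((\<I> \<odot> X) \<odot> A) \<longleftrightarrow>
    Ide V X \<bullet> (\<omega> A \<cdot> m \<cdot> (e \<bullet> Ide V A)) = Ide V (X \<odot> (\<I> \<odot> A))"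
proof -
  define k where "k = (\<wp> X \<bullet> Ide V A) \<cdot> inv_arr V (\<gamma> X \<I> A)"
  have k: "iso V k" "Dom V k = X \<odot> (\<I> \<odot> A)" "Cod V k = (\<I> \<odot> X) \<odot> A"
    unfolding k_def wp_def by auto
  have inv_k: "inv_arr V k = \<gamma> X \<I> A \<cdot> (\<ell> X \<bullet> Ide V A)"
    by (rule inv_arr_eq) (auto simp: k_def wp_def inverse_arrows_def in_hom)
  have om: "\<omega> X \<bullet> Ide V A = k \<cdot> (Ide V X \<bullet> \<omega> A)"
    by (simp add: omega_balanced k_def wp_def)
  have nat: "\<gamma> X A A \<cdot> ((Ide V X \<bullet> e) \<bullet> Ide V A) = (Ide V X \<bullet> (e \<bullet> Ide V A)) \<cdot> \<gamma> X \<I> A"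
    using assoc_natural[of "Ide V X" e "Ide V A"] by simp
  have "(\<omega> X \<bullet> Ide V A) \<cdot> ((Ide V X \<bullet> m) \<cdot> \<gamma> X A A) \<cdot> (((Ide V X \<bullet> e) \<cdot> \<ell> X) \<bullet> Ide V A)
      = (\<omega> X \<bullet> Ide V A) \<cdot> (Ide V X \<bullet> m) \<cdot> (\<gamma> X A A \<cdot> ((Ide V X \<bullet> e) \<bullet> Ide V A)) \<cdot> (\<ell> X \<bullet> Ide V A)"
    by simp
  also have "\<dots> = k \<cdot> (Ide V X \<bullet> (\<omega> A \<cdot> m \<cdot> (e \<bullet> Ide V A))) \<cdot> inv_arr V k"
    unfolding nat om inv_k by (simp add: k)
  finally show ?thesis
    using conjugate_eq_Ide_iff[OF k(1), of "Ide V X \<bullet> (\<omega> A \<cdot> m \<cdot> (e \<bullet> Ide V A))"]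
    by (simp add: k)
qed

lemma left_associativity:
  assumes [simp]: "A \<in> Obj V" "X \<in> Obj V" "m \<in> Arr V" "Dom V m = A \<odot> A" "Cod V m = A"
  defines "mu \<equiv> \<lambda>X. (m \<bullet> Ide V X) \<cdot> inv_arr V (\<gamma> A A X)"
  shows "mu X \<cdot> (Ide V A \<bullet> mu X) = mu X \<cdot> mu (A \<odot> X) \<longleftrightarrow>
    (m \<cdot> (m \<bullet> Ide V A)) \<bullet> Ide V X = (m \<cdot> (Ide V A \<bullet> m) \<cdot> \<gamma> A A A) \<bullet> Ide V X"
proof -
  define k where "k = (inv_arr V (\<gamma> A A A) \<bullet> Ide V X) \<cdot> inv_arr V (\<gamma> A (A \<odot> A) X)
    \<cdot> (Ide V A \<bullet> inv_arr V (\<gamma> A A X))"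
  have k: "iso V k" "Cod V k = ((A \<odot> A) \<odot> A) \<odot> X" "Dom V k = A \<odot> (A \<odot> (A \<odot> X))"
    unfolding k_def by auto
  have pent: "inv_arr V (\<gamma> (A \<odot> A) A X) \<cdot> inv_arr V (\<gamma> A A (A \<odot> X)) = k"
  proof -
    have "inv_arr V (\<gamma> (A \<odot> A) A X) \<cdot> inv_arr V (\<gamma> A A (A \<odot> X))
        = inv_arr V (\<gamma> A A (A \<odot> X) \<cdot> \<gamma> (A \<odot> A) A X)"
      by (simp add: inv_arr_Cmp_distrib)
    then show ?thesis
      by (simp add: pentagon k_def inv_arr_Cmp_distrib inv_arr_tensor)
  qed
  have nat1: "inv_arr V (\<gamma> A A X) \<cdot> (Ide V A \<bullet> (m \<bullet> Ide V X))
      = ((Ide V A \<bullet> m) \<bullet> Ide V X) \<cdot> inv_arr V (\<gamma> A (A \<odot> A) X)"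
    using inv_assoc_natural[of "Ide V A" m "Ide V X"] by simp
  have nat2: "inv_arr V (\<gamma> A A X) \<cdot> (m \<bullet> Ide V (A \<odot> X))
      = ((m \<bullet> Ide V A) \<bullet> Ide V X) \<cdot> inv_arr V (\<gamma> (A \<odot> A) A X)"
    using inv_assoc_natural[of m "Ide V A" "Ide V X"] by simp
  have "mu X \<cdot> (Ide V A \<bullet> mu X)
      = (m \<bullet> Ide V X) \<cdot> (inv_arr V (\<gamma> A A X) \<cdot> (Ide V A \<bullet> (m \<bullet> Ide V X)))
        \<cdot> (Ide V A \<bullet> inv_arr V (\<gamma> A A X))"
    by (simp add: mu_def)
  also have "\<dots> = ((m \<cdot> (Ide V A \<bullet> m) \<cdot> \<gamma> A A A) \<bullet> Ide V X) \<cdot> k"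
    unfolding nat1 by (simp add: k_def)
  finally have l: "mu X \<cdot> (Ide V A \<bullet> mu X) = ((m \<cdot> (Ide V A \<bullet> m) \<cdot> \<gamma> A A A) \<bullet> Ide V X) \<cdot> k" .
  have "mu X \<cdot> mu (A \<odot> X) = (m \<bullet> Ide V X) \<cdot> (inv_arr V (\<gamma> A A X) \<cdot> (m \<bullet> Ide V (A \<odot> X)))
      \<cdot> inv_arr V (\<gamma> A A (A \<odot> X))"
    by (simp add: mu_def)
  also have "\<dots> = ((m \<cdot> (m \<bullet> Ide V A)) \<bullet> Ide V X) \<cdot> k"
    unfolding nat2 pent[symmetric] by simp
  finally have r: "mu X \<cdot> mu (A \<odot> X) = ((m \<cdot> (m \<bullet> Ide V A)) \<bullet> Ide V X) \<cdot> k" .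
  show ?thesis
    unfolding l r by (auto dest: iso_epic[OF k(1)] simp: k)
qed

lemma left_unit_outer:
  assumes [simp]: "A \<in> Obj V" "X \<in> Obj V" "m \<in> Arr V" "Dom V m = A \<odot> A" "Cod V m = A"
    "e \<in> Arr V" "Dom V e = \<I>" "Cod V e = A"
  shows "\<omega> (A \<odot> X) \<cdot> ((m \<bullet> Ide V X) \<cdot> inv_arr V (\<gamma> A A X)) \<cdot> (e \<bullet> Ide V (A \<odot> X))
      = Ide V (\<I> \<odot> (A \<odot> X)) \<longleftrightarrow>
    (\<omega> A \<cdot> m \<cdot> (e \<bullet> Ide V A)) \<bullet> Ide V X = Ide V ((\<I> \<odot> A) \<odot> X)"
proof -
  have nat: "inv_arr V (\<gamma> A A X) \<cdot> (e \<bullet> Ide V (A \<odot> X))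
      = ((e \<bullet> Ide V A) \<bullet> Ide V X) \<cdot> inv_arr V (\<gamma> \<I> A X)"
    using inv_assoc_natural[of e "Ide V A" "Ide V X"] by simp
  have "\<omega> (A \<odot> X) \<cdot> ((m \<bullet> Ide V X) \<cdot> inv_arr V (\<gamma> A A X)) \<cdot> (e \<bullet> Ide V (A \<odot> X))
      = \<omega> (A \<odot> X) \<cdot> (m \<bullet> Ide V X) \<cdot> (inv_arr V (\<gamma> A A X) \<cdot> (e \<bullet> Ide V (A \<odot> X)))"
    by simp
  also have "\<dots> = \<gamma> \<I> A X \<cdot> ((\<omega> A \<cdot> m \<cdot> (e \<bullet> Ide V A)) \<bullet> Ide V X) \<cdot> inv_arr V (\<gamma> \<I> A X)"
    unfolding nat by (simp add: omega_tensor_left)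
  finally show ?thesis
    using conjugate_eq_Ide_iff[of "\<gamma> \<I> A X" "(\<omega> A \<cdot> m \<cdot> (e \<bullet> Ide V A)) \<bullet> Ide V X"] by simp
qed

lemma left_unit_inner:
  assumes [simp]: "A \<in> Obj V" "X \<in> Obj V" "m \<in> Arr V" "Dom V m = A \<odot> A" "Cod V m = A"
    "e \<in> Arr V" "Dom V e = \<I>" "Cod V e = A"
  shows "(Ide V A \<bullet> \<omega> X) \<cdot> ((m \<bullet> Ide V X) \<cdot> inv_arr V (\<gamma> A A X)) \<cdot> (Ide V A \<bullet> (e \<bullet> Ide V X))
      = Ide V (A \<odot> (\<I> \<odot> X)) \<longleftrightarrow>
    (\<omega> A \<cdot> m \<cdot> (Ide V A \<bullet> e) \<cdot> \<ell> A) \<bullet> Ide V X = Ide V ((\<I> \<odot> A) \<odot> X)"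
proof -
  define k where "k = \<gamma> A \<I> X \<cdot> (\<ell> A \<bullet> Ide V X)"
  have k: "iso V k" "Dom V k = (\<I> \<odot> A) \<odot> X" "Cod V k = A \<odot> (\<I> \<odot> X)"
    unfolding k_def by auto
  have inv_k: "inv_arr V k = (inv_arr V (\<ell> A) \<bullet> Ide V X) \<cdot> inv_arr V (\<gamma> A \<I> X)"
    by (rule inv_arr_eq) (auto simp: k_def inverse_arrows_def in_hom)
  have om: "Ide V A \<bullet> \<omega> X = k \<cdot> (\<omega> A \<bullet> Ide V X)"
    by (simp add: omega_balanced k_def)
  have nat: "inv_arr V (\<gamma> A A X) \<cdot> (Ide V A \<bullet> (e \<bullet> Ide V X))
      = ((Ide V A \<bullet> e) \<bullet> Ide V X) \<cdot> inv_arr V (\<gamma> A \<I> X)"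
    using inv_assoc_natural[of "Ide V A" e "Ide V X"] by simp
  have "(Ide V A \<bullet> \<omega> X) \<cdot> ((m \<bullet> Ide V X) \<cdot> inv_arr V (\<gamma> A A X)) \<cdot> (Ide V A \<bullet> (e \<bullet> Ide V X))
      = (Ide V A \<bullet> \<omega> X) \<cdot> (m \<bullet> Ide V X) \<cdot> (inv_arr V (\<gamma> A A X) \<cdot> (Ide V A \<bullet> (e \<bullet> Ide V X)))"
    by simp
  also have "\<dots> = k \<cdot> ((\<omega> A \<cdot> m \<cdot> (Ide V A \<bullet> e) \<cdot> \<ell> A) \<bullet> Ide V X) \<cdot> inv_arr V k"
    unfolding nat om inv_k by (simp add: k)
  finally show ?thesis
    using conjugate_eq_Ide_iff[OF k(1), of "(\<omega> A \<cdot> m \<cdot> (Ide V A \<bullet> e) \<cdot> \<ell> A) \<bullet> Ide V X"]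
    by (simp add: k)
qed

end

section \<open>Colimits and generators\<close>

context category
begin

lemma natural_transformationI:
  assumes "\<And>X. X \<in> Obj C \<Longrightarrow>
      \<tau> X \<in> Arr C \<and> Dom C (\<tau> X) = obj_map F X \<and> Cod C (\<tau> X) = obj_map G X"
    and "\<And>f. f \<in> Arr C \<Longrightarrow> \<tau> (Cod C f) \<cdot> arr_map F f = arr_map G f \<cdot> \<tau> (Dom C f)"
  shows "natural_transformation C C F G \<tau>"
  using assms by (auto simp: natural_transformation_def in_hom)

lemma natural_transformationD:
  assumes "natural_transformation C C F G \<tau>"
  shows "X \<in> Obj C \<Longrightarrow> \<tau> X \<in> Arr C"
    and "X \<in> Obj C \<Longrightarrow> Dom C (\<tau> X) = obj_map F X"
    and "X \<in> Obj C \<Longrightarrow> Cod C (\<tau> X) = obj_map G X"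
    and "f \<in> Arr C \<Longrightarrow> \<tau> (Cod C f) \<cdot> arr_map F f = arr_map G f \<cdot> \<tau> (Dom C f)"
  using assms by (auto simp: natural_transformation_def in_hom)

lemma functor_typing:
  assumes "is_functor C C F" "f \<in> Arr C"
  shows "arr_map F f \<in> Arr C" "Dom C (arr_map F f) = obj_map F (Dom C f)"
    "Cod C (arr_map F f) = obj_map F (Cod C f)"
  using assms by (auto simp: is_functor_def in_hom)

lemma functor_Cmp:
  assumes "is_functor C C F" "f \<in> Arr C" "g \<in> Arr C" "Dom C g = Cod C f"
  shows "arr_map F (g \<cdot> f) = arr_map F g \<cdot> arr_map F f"
proof -
  have "f \<in> hom C (Dom C f) (Cod C f)" "g \<in> hom C (Cod C f) (Cod C g)"
    using assms(2-4) by (auto simp: in_hom)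
  then show ?thesis
    using assms(1) unfolding is_functor_def by blast
qed

lemma is_functor_comp:
  assumes "is_functor J C D" "is_functor C C F"
  shows "is_functor J C (F \<circ>\<^sub>F D)"
  using assms unfolding is_functor_def comp_functor_def by simp blast

lemma is_functor_id: "is_functor C C id_functor"
  by (auto simp: is_functor_def id_functor_def)

lemma preserves_colimits_comp:
  assumes "is_functor C C F" "preserves_colimits TYPE('u) C C F" "preserves_colimits TYPE('u) C C H"
  shows "preserves_colimits TYPE('u) C C (H \<circ>\<^sub>F F)"
  unfolding preserves_colimits_def
proof (intro allI impI, elim conjE)
  fix J :: "('u, 'u) category_data" and D L \<iota>
  assume J: "small_category J" and D: "is_functor J C D" and L: "is_colimit J C D L \<iota>"
  then have "is_colimit J C (F \<circ>\<^sub>F D) (obj_map F L) (\<lambda>j. arr_map F (\<iota> j))"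
    using assms(2) by (auto simp: preserves_colimits_def)
  with J is_functor_comp[OF D assms(1)]
  have "is_colimit J C (H \<circ>\<^sub>F (F \<circ>\<^sub>F D)) (obj_map H (obj_map F L)) (\<lambda>j. arr_map H (arr_map F (\<iota> j)))"
    using assms(3) unfolding preserves_colimits_def by blast
  then show "is_colimit J C ((H \<circ>\<^sub>F F) \<circ>\<^sub>F D) (obj_map (H \<circ>\<^sub>F F) L) (\<lambda>j. arr_map (H \<circ>\<^sub>F F) (\<iota> j))"
    by (simp add: comp_functor_def o_assoc)
qed

lemma preserves_colimits_id: "preserves_colimits TYPE('u) C C id_functor"
proof -
  have "id_functor \<circ>\<^sub>F D = D" for D :: "('u, 'u, 'o, 'm) functor_data"
    by (cases D) (simp add: comp_functor_def id_functor_def o_def)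
  then show ?thesis
    by (simp add: preserves_colimits_def) (simp add: id_functor_def)
qed

lemma colimit_legs_jointly_epic:
  assumes L: "is_colimit J C D L \<iota>" and D: "is_functor J C D"
    and st: "s \<in> hom C L Z" "t \<in> hom C L Z" "\<And>j. j \<in> Obj J \<Longrightarrow> s \<cdot> \<iota> j = t \<cdot> \<iota> j"
    and J: "category J"
  shows "s = t"
proof -
  have cocone: "is_cocone J C D L \<iota>"
    using L by (simp add: is_colimit_def)
  have "is_cocone J C D Z (\<lambda>j. t \<cdot> \<iota> j)"
    unfolding is_cocone_def
  proof (intro conjI ballI allI)
    show "Z \<in> Obj C"
      using st(1) by (auto simp: in_hom)
    show "t \<cdot> \<iota> j \<in> hom C (obj_map D j) Z" if "j \<in> Obj J" for j
      using that cocone st(2) by (auto simp: is_cocone_def intro: Cmp_hom)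
    fix i j u
    assume u: "u \<in> hom J i j"
    then have j: "j \<in> Obj J" "i \<in> Obj J"
      using category.Cod_closed[OF J] category.Dom_closed[OF J] by (auto simp: hom_def)
    have "arr_map D u \<in> hom C (obj_map D i) (obj_map D j)"
      using D u by (auto simp: is_functor_def)
    moreover have "\<iota> j \<in> hom C (obj_map D j) L" "\<iota> j \<cdot> arr_map D u = \<iota> i"
      using cocone j u by (auto simp: is_cocone_def)
    ultimately show "(t \<cdot> \<iota> j) \<cdot> arr_map D u = t \<cdot> \<iota> i"
      using Cmp_assoc st(2) by metis
  qed
  then have "\<exists>!h. h \<in> hom C L Z \<and> (\<forall>j \<in> Obj J. h \<cdot> \<iota> j = t \<cdot> \<iota> j)"
    using L by (simp add: is_colimit_def)
  then show ?thesis
    using st by blast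
qed

text \<open>Preservation of colimits only speaks of diagrams whose objects and arrows lie in \<open>'u\<close>, so the
  index set of the coproduct, which is small but lives elsewhere, is first injected into \<open>'u\<close>.\<close>

lemma preserved_coproduct_jointly_epic:
  fixes S :: "'i set"
  assumes F: "is_functor C C F" and pres: "preserves_colimits TYPE('u) C C F"
    and small: "small TYPE('u) S"
    and P: "is_coproduct C S X P \<iota>" and X: "\<And>i. i \<in> S \<Longrightarrow> X i \<in> Obj C"
    and st: "s \<in> hom C (obj_map F P) Z" "t \<in> hom C (obj_map F P) Z"
      "\<And>i. i \<in> S \<Longrightarrow> s \<cdot> arr_map F (\<iota> i) = t \<cdot> arr_map F (\<iota> i)"
  shows "s = t"
proof -
  obtain \<phi> :: "'i \<Rightarrow> 'u" where \<phi>: "inj_on \<phi> S"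
    using small unfolding small_def lesspoll_def lepoll_def by blast
  define J where "J = discrete_category (\<phi> ` S)"
  define r where "r = inv_into S \<phi>"
  define D where "D = \<lparr>obj_map = X \<circ> r, arr_map = (\<lambda>u. Ide C (X (r u)))\<rparr>"
  have r [simp]: "r (\<phi> i) = i" if "i \<in> S" for i
    using \<phi> that by (simp add: r_def)
  have J: "category J"
    by unfold_locales (auto simp: J_def discrete_category_def hom_def)
  have "\<phi> ` S \<prec> (UNIV :: 'u set)"
    using small inj_on_image_eqpoll_self[OF \<phi>] unfolding small_def by (rule eq_lesspoll_trans[rotated])
  then have smallJ: "small_category J"
    using J by (simp add: small_category_def small_def J_def discrete_category_def)
  have D: "is_functor J C D"
    using X by (auto simp: is_functor_def D_def J_def discrete_category_def in_hom hom_def)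
  have cocones: "is_cocone J C D K \<kappa> \<longleftrightarrow>
      is_cocone (discrete_category S) C \<lparr>obj_map = X, arr_map = (\<lambda>i. Ide C (X i))\<rparr> K (\<kappa> \<circ> \<phi>)" for K \<kappa>
    by (auto simp: is_cocone_def J_def D_def discrete_category_def hom_def)
  have "is_colimit J C D P (\<iota> \<circ> r)"
    unfolding is_colimit_def
  proof (intro conjI allI impI)
    have "is_cocone (discrete_category S) C \<lparr>obj_map = X, arr_map = (\<lambda>i. Ide C (X i))\<rparr> P \<iota>"
      using P by (simp add: is_coproduct_def is_colimit_def)
    then show "is_cocone J C D P (\<iota> \<circ> r)"
      unfolding cocones by (auto simp: is_cocone_def discrete_category_def hom_def)
    fix K \<kappa>
    assume "is_cocone J C D K \<kappa>"
    then have "\<exists>!h. h \<in> hom C P K \<and> (\<forall>i \<in> Obj (discrete_category S). h \<cdot> \<iota> i = (\<kappa> \<circ> \<phi>) i)"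
      using P unfolding cocones is_coproduct_def is_colimit_def by blast
    then show "\<exists>!h. h \<in> hom C P K \<and> (\<forall>j \<in> Obj J. h \<cdot> (\<iota> \<circ> r) j = \<kappa> j)"
      by (simp add: J_def discrete_category_def)
  qed
  then have "is_colimit J C (F \<circ>\<^sub>F D) (obj_map F P) (\<lambda>j. arr_map F ((\<iota> \<circ> r) j))"
    using pres smallJ D unfolding preserves_colimits_def by blast
  then show ?thesis
    by (rule colimit_legs_jointly_epic[OF _ is_functor_comp[OF D F] st(1,2) _ J])
      (auto simp: J_def discrete_category_def st(3))
qed

text \<open>A coequalizer is the colimit of a diagram with two objects and four arrows, and an infinite
  \<open>'u\<close> has room for these.\<close>

lemma preserved_regular_epi_epic:
  assumes inf: "infinite (UNIV :: 'u set)"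
    and F: "is_functor C C F" and pres: "preserves_colimits TYPE('u) C C F"
    and e: "regular_epi C e"
    and st: "s \<in> hom C (obj_map F (Cod C e)) Z" "t \<in> hom C (obj_map F (Cod C e)) Z"
      "s \<cdot> arr_map F e = t \<cdot> arr_map F e"
  shows "s = t"
proof -
  obtain f g where coeq: "is_coequalizer C f g e"
    using e by (auto simp: regular_epi_def)
  then have fge: "f \<in> Arr C" "g \<in> Arr C" "Dom C g = Dom C f" "Cod C g = Cod C f"
    "e \<in> Arr C" "Dom C e = Cod C f" "e \<cdot> f = e \<cdot> g"
    by (auto simp: is_coequalizer_def in_hom)
  obtain B :: "'u set" where "finite B" "card B = 4"
    using infinite_arbitrarily_large[OF inf] by blast
  then obtain a b c d :: 'u where [simp]: "a \<noteq> b" "a \<noteq> c" "a \<noteq> d" "b \<noteq> c" "b \<noteq> d" "c \<noteq> d"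
    by (auto simp: numeral_eq_Suc card_Suc_eq)
  note [simp] = \<open>a \<noteq> b\<close>[symmetric] \<open>a \<noteq> c\<close>[symmetric] \<open>a \<noteq> d\<close>[symmetric] \<open>b \<noteq> c\<close>[symmetric]
    \<open>b \<noteq> d\<close>[symmetric] \<open>c \<noteq> d\<close>[symmetric]
  \<comment> \<open>The objects \<open>a\<close> and \<open>b\<close> serve as their own identities; \<open>c\<close> and \<open>d\<close> are the two arrows
    from \<open>a\<close> to \<open>b\<close>.\<close>
  define J where "J = \<lparr>Obj = {a, b}, Arr = {a, b, c, d}, Dom = (\<lambda>x. if x = b then b else a),
    Cod = (\<lambda>x. if x = a then a else b), Ide = (\<lambda>x. x), Cmp = (\<lambda>y x. if x = a then y else x)\<rparr>"
  define D where "D = \<lparr>obj_map = (\<lambda>x. if x = a then Dom C f else Cod C f),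
    arr_map = (\<lambda>x. if x = a then Ide C (Dom C f) else if x = b then Ide C (Cod C f)
      else if x = c then f else g)\<rparr>"
  define \<iota> where "\<iota> = (\<lambda>x. if x = a then e \<cdot> f else e)"
  have homJ: "u \<in> hom J i j \<longleftrightarrow> u = a \<and> i = a \<and> j = a \<or> u = b \<and> i = b \<and> j = b
      \<or> u = c \<and> i = a \<and> j = b \<or> u = d \<and> i = a \<and> j = b" for u i j
    by (auto simp: J_def hom_def)
  have J: "category J"
  proof
    fix u
    assume "u \<in> Arr J"
    then show "Dom J u \<in> Obj J" "Cod J u \<in> Obj J"
      by (auto simp: J_def)
  next
    fix i
    assume "i \<in> Obj J"
    then show "Ide J i \<in> hom J i i"
      by (auto simp: homJ) (auto simp: J_def)
  qed (unfold homJ, unfold J_def, auto)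
  have "Arr J \<prec> (UNIV :: 'u set)"
    by (rule finite_lesspoll_infinite[OF inf]) (simp add: J_def)
  then have smallJ: "small_category J"
    using J by (simp add: small_category_def small_def)
  have D: "is_functor J C D"
    unfolding is_functor_def
  proof (intro conjI)
    show "\<forall>i j k. \<forall>u \<in> hom J i j. \<forall>v \<in> hom J j k.
        arr_map D (v \<cdot>\<^bsub>J\<^esub> u) = arr_map D v \<cdot> arr_map D u"
      unfolding homJ Ball_def by (intro allI impI, elim disjE conjE; simp add: D_def J_def fge)
    show "\<forall>i j. \<forall>u \<in> hom J i j. arr_map D u \<in> hom C (obj_map D i) (obj_map D j)"
      unfolding homJ Ball_def by (intro allI impI, elim disjE conjE; simp add: D_def in_hom fge)
  qed (auto simp: J_def D_def fge)
  have cocones: "is_cocone J C D K \<kappa> \<longleftrightarrow> K \<in> Obj C \<and> \<kappa> b \<in> hom C (Cod C f) K \<and>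
      \<kappa> a = \<kappa> b \<cdot> f \<and> \<kappa> a = \<kappa> b \<cdot> g" for K \<kappa>
    unfolding is_cocone_def homJ Ball_def
    by (simp add: J_def D_def imp_disjL imp_conjL all_conj_distrib)
      (auto simp: in_hom fge)
  have "is_colimit J C D (Cod C e) \<iota>"
    unfolding is_colimit_def
  proof (intro conjI allI impI)
    show "is_cocone J C D (Cod C e) \<iota>"
      unfolding cocones by (auto simp: \<iota>_def in_hom fge)
    fix K \<kappa>
    assume K: "is_cocone J C D K \<kappa>"
    then have "\<kappa> b \<in> hom C (Cod C f) K" "\<kappa> b \<cdot> f = \<kappa> b \<cdot> g"
      unfolding cocones by metis+
    then have "\<exists>!h. h \<in> hom C (Cod C e) K \<and> h \<cdot> e = \<kappa> b"
      using coeq unfolding is_coequalizer_def by blast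
    moreover have "(\<forall>j \<in> Obj J. h \<cdot> \<iota> j = \<kappa> j) \<longleftrightarrow> h \<cdot> e = \<kappa> b" if "h \<in> hom C (Cod C e) K" for h
    proof -
      have "h \<cdot> (e \<cdot> f) = (h \<cdot> e) \<cdot> f"
        using that fge by (simp add: in_hom)
      then show ?thesis
        using K unfolding cocones by (auto simp: J_def \<iota>_def)
    qed
    ultimately show "\<exists>!h. h \<in> hom C (Cod C e) K \<and> (\<forall>j \<in> Obj J. h \<cdot> \<iota> j = \<kappa> j)"
      by metis
  qed
  then have "is_colimit J C (F \<circ>\<^sub>F D) (obj_map F (Cod C e)) (\<lambda>j. arr_map F (\<iota> j))"
    using pres smallJ D by (auto simp: preserves_colimits_def)
  moreover have "s \<cdot> arr_map F (\<iota> j) = t \<cdot> arr_map F (\<iota> j)" if "j \<in> Obj J" for j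
  proof -
    have "s \<cdot> arr_map F (e \<cdot> f) = (s \<cdot> arr_map F e) \<cdot> arr_map F f"
      "t \<cdot> arr_map F (e \<cdot> f) = (t \<cdot> arr_map F e) \<cdot> arr_map F f"
      using st(1,2) fge(1-6) by (simp_all add: functor_Cmp[OF F] functor_typing[OF F] in_hom)
    then show ?thesis
      using st(3) by (simp add: \<iota>_def)
  qed
  ultimately show ?thesis
    by (rule colimit_legs_jointly_epic[OF _ is_functor_comp[OF D F] st(1,2) _ J])
qed

text \<open>The canonical morphism from a coproduct of copies of \<open>G\<close> to \<open>X\<close> and the legs of that coproduct
  stay epic, respectively jointly epic, under \<open>F\<close>; so a natural transformation out of \<open>F\<close> is
  determined at \<open>X\<close> by its naturality squares along the arrows from \<open>G\<close> to \<open>X\<close>.\<close>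

lemma natural_transformations_eq_if_eq_at_generator:
  assumes inf: "infinite (UNIV :: 'u set)"
    and ls: "locally_small TYPE('u) C" and G: "regular_generator C G"
    and F: "is_functor C C F" and pres: "preserves_colimits TYPE('u) C C F"
    and \<sigma>: "natural_transformation C C F H \<sigma>" and \<tau>: "natural_transformation C C F H \<tau>"
    and eq: "\<sigma> G = \<tau> G" and X: "X \<in> Obj C"
  shows "\<sigma> X = \<tau> X"
proof -
  have GO: "G \<in> Obj C"
    using G by (simp add: regular_generator_def)
  obtain P \<iota> e where P: "is_coproduct C (hom C G X) (\<lambda>_. G) P \<iota>"
    and e: "e \<in> hom C P X" "\<And>f. f \<in> hom C G X \<Longrightarrow> e \<cdot> \<iota> f = f" "regular_epi C e"
    using G X unfolding regular_generator_def by blast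
  have \<iota>: "\<iota> f \<in> Arr C" "Dom C (\<iota> f) = G" "Cod C (\<iota> f) = P" if "f \<in> hom C G X" for f
    using P that
    by (auto simp: is_coproduct_def is_colimit_def is_cocone_def discrete_category_def in_hom)
  have e': "e \<in> Arr C" "Dom C e = P" "Cod C e = X"
    using e(1) by (auto simp: in_hom)
  note ty = natural_transformationD(1-3)[OF \<sigma>] natural_transformationD(1-3)[OF \<tau>]
    functor_typing[OF F]
  have leg: "\<upsilon> X \<cdot> arr_map F e \<cdot> arr_map F (\<iota> f) = arr_map H f \<cdot> \<upsilon> G"
    if \<upsilon>: "natural_transformation C C F H \<upsilon>" and f: "f \<in> hom C G X" for \<upsilon> f
    using natural_transformationD(4)[OF \<upsilon>, of f] f \<iota>[OF f] e'
    by (simp add: e(2) in_hom flip: functor_Cmp[OF F])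
  have "\<sigma> X \<cdot> arr_map F e = \<tau> X \<cdot> arr_map F e"
  proof (rule preserved_coproduct_jointly_epic[OF F pres _ P])
    show "small TYPE('u) (hom C G X)"
      using ls X GO by (simp add: locally_small_def)
    show "\<sigma> X \<cdot> arr_map F e \<in> hom C (obj_map F P) (obj_map H X)"
      "\<tau> X \<cdot> arr_map F e \<in> hom C (obj_map F P) (obj_map H X)"
      using X e' by (auto simp: in_hom ty)
    fix f
    assume f: "f \<in> hom C G X"
    then show "(\<sigma> X \<cdot> arr_map F e) \<cdot> arr_map F (\<iota> f) = (\<tau> X \<cdot> arr_map F e) \<cdot> arr_map F (\<iota> f)"
      using leg[OF \<sigma> f] leg[OF \<tau> f] \<iota>[OF f] e' X by (simp add: ty eq)
  qed (rule GO)
  then show ?thesis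
    by (rule preserved_regular_epi_epic[OF inf F pres e(3), rotated -1])
      (use X e' in \<open>auto simp: in_hom ty\<close>)
qed

end

section \<open>Firm objects\<close>

context semiunital_semimonoidal_category
begin

lemma firm_Obj: "firm V X \<Longrightarrow> X \<in> Obj V"
  by (simp add: firm_def)

lemma firm_iso: "firm V X \<Longrightarrow> iso V (\<omega> X)"
  by (simp add: firm_def)

text \<open>Firmness is inherited by every product with a firm factor on either side.  In particular all
  values of the functors \<open>- \<bullet> A\<close> and \<open>A \<bullet> -\<close> are firm, although a general object is not known to
  be.\<close>

lemma firm_tensor_left:
  assumes "firm V A" "X \<in> Obj V"
  shows "firm V (A \<odot> X)"
  using assms by (auto simp: firm_def omega_tensor_left)

lemma firm_tensor_right:
  assumes "firm V A" "X \<in> Obj V"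
  shows "firm V (X \<odot> A)"
  using assms by (auto simp: firm_def omega_tensor_right wp_def)

lemma semiunit_tensor_omega_iso:
  assumes "firm V \<I>" "X \<in> Obj V"
  shows "iso V (Ide V \<I> \<bullet> \<omega> X)"
  using assms by (auto simp: firm_def omega_balanced)

text \<open>Between firm objects, naturality of \<open>\<omega>\<close> conjugates \<open>\<I> \<bullet> g\<close> to \<open>g\<close>, so tensoring with the
  semiunit loses and adds nothing; \<open>\<ell>\<close> carries this over to tensoring on the other side.\<close>

lemma semiunit_tensor_faithful:
  assumes f: "f \<in> hom V X Y" and g: "g \<in> hom V X Y" and Y: "firm V Y"
    and eq: "Ide V \<I> \<bullet> f = Ide V \<I> \<bullet> g"
  shows "f = g"
proof (rule iso_monic[OF firm_iso[OF Y]])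
  show "\<omega> Y \<cdot> f = \<omega> Y \<cdot> g"
    using omega_nat[of f] omega_nat[of g] f g eq by (simp add: in_hom)
qed (use f g firm_Obj[OF Y] in \<open>auto simp: in_hom\<close>)

lemma semiunit_tensor_full:
  assumes h: "h \<in> hom V (\<I> \<odot> X) (\<I> \<odot> Y)" and X: "firm V X" and Y: "firm V Y"
  obtains g where "g \<in> hom V X Y" "Ide V \<I> \<bullet> g = h"
proof
  note [simp] = firm_Obj[OF X] firm_Obj[OF Y] firm_iso[OF X] firm_iso[OF Y]
  define g where "g = inv_arr V (\<omega> Y) \<cdot> h \<cdot> \<omega> X"
  have h': "h \<in> Arr V" "Dom V h = \<I> \<odot> X" "Cod V h = \<I> \<odot> Y"
    using h by (auto simp: in_hom)
  have g: "g \<in> Arr V" "Dom V g = X" "Cod V g = Y"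
    by (auto simp: g_def h')
  then show "g \<in> hom V X Y"
    by (simp add: in_hom)
  have "(Ide V \<I> \<bullet> g) \<cdot> \<omega> X = \<omega> Y \<cdot> g"
    using omega_nat[of g] g by simp
  also have "\<dots> = h \<cdot> \<omega> X"
    by (simp add: g_def h')
  finally show "Ide V \<I> \<bullet> g = h"
    by (rule iso_epic[OF firm_iso[OF X]]) (simp_all add: g h')
qed

lemma tensor_semiunit_faithful:
  assumes f: "f \<in> hom V X Y" and g: "g \<in> hom V X Y" and Y: "firm V Y"
    and eq: "f \<bullet> Ide V \<I> = g \<bullet> Ide V \<I>"
  shows "f = g"
proof (rule semiunit_tensor_faithful[OF f g Y])
  have X: "X \<in> Obj V"
    using f by (auto simp: in_hom)
  show "Ide V \<I> \<bullet> f = Ide V \<I> \<bullet> g"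
    by (rule iso_monic[of "\<ell> Y"])
      (use ell_nat[of f] ell_nat[of g] f g eq X firm_Obj[OF Y] in \<open>auto simp: in_hom\<close>)
qed

lemma tensor_semiunit_full:
  assumes h: "h \<in> hom V (X \<odot> \<I>) (Y \<odot> \<I>)" and X: "firm V X" and Y: "firm V Y"
  obtains g where "g \<in> hom V X Y" "g \<bullet> Ide V \<I> = h"
proof -
  note [simp] = firm_Obj[OF X] firm_Obj[OF Y]
  have h': "h \<in> Arr V" "Dom V h = X \<odot> \<I>" "Cod V h = Y \<odot> \<I>"
    using h by (auto simp: in_hom)
  have "inv_arr V (\<ell> Y) \<cdot> h \<cdot> \<ell> X \<in> hom V (\<I> \<odot> X) (\<I> \<odot> Y)"
    by (simp add: in_hom h')
  then obtain g where g: "g \<in> hom V X Y" "Ide V \<I> \<bullet> g = inv_arr V (\<ell> Y) \<cdot> h \<cdot> \<ell> X"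
    using semiunit_tensor_full[OF _ X Y] by blast
  then have g': "g \<in> Arr V" "Dom V g = X" "Cod V g = Y"
    by (auto simp: in_hom)
  have "(g \<bullet> Ide V \<I>) \<cdot> \<ell> X = h \<cdot> \<ell> X"
    using ell_nat[of g] by (simp add: g(2) g' h')
  then have "g \<bullet> Ide V \<I> = h"
    by (rule iso_epic[OF ell_iso, rotated]) (simp_all add: g' h')
  with g(1) show thesis
    by (rule that)
qed

text \<open>The functor \<open>\<J>\<close> need not preserve colimits, so the generator does not compare
  transformations out of \<open>\<J>\<close> directly.  It does compare their composites with \<open>\<omega>\<close>, which start at
  the identity functor; and since \<open>\<I> \<bullet> \<omega> X\<close> is invertible, an arrow from \<open>\<J> X\<close> to a firm object is
  determined by its composite with \<open>\<omega> X\<close>.\<close>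

lemma transformations_from_J_eq_if_eq_at_semiunit:
  assumes inf: "infinite (UNIV :: 'u set)"
    and ls: "locally_small TYPE('u) V" and gen: "regular_generator V \<I>" and I: "firm V \<I>"
    and M: "is_functor V V M" "\<And>X. X \<in> Obj V \<Longrightarrow> firm V (obj_map M X)"
    and \<sigma>: "natural_transformation V V (left_tensor V \<I>) M \<sigma>"
    and \<tau>: "natural_transformation V V (left_tensor V \<I>) M \<tau>"
    and eq: "\<sigma> \<I> = \<tau> \<I>" and X: "X \<in> Obj V"
  shows "\<sigma> X = \<tau> X"
proof -
  have ty: "\<upsilon> Y \<in> Arr V" "Dom V (\<upsilon> Y) = \<I> \<odot> Y" "Cod V (\<upsilon> Y) = obj_map M Y"
    if "natural_transformation V V (left_tensor V \<I>) M \<upsilon>" "Y \<in> Obj V" for \<upsilon> Y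
    using natural_transformationD(1-3)[OF that] by (auto simp: left_tensor_def)
  have comp: "natural_transformation V V id_functor M (\<lambda>Y. \<upsilon> Y \<cdot> \<omega> Y)"
    if \<upsilon>: "natural_transformation V V (left_tensor V \<I>) M \<upsilon>" for \<upsilon>
  proof (rule natural_transformationI)
    show "\<upsilon> Y \<cdot> \<omega> Y \<in> Arr V \<and> Dom V (\<upsilon> Y \<cdot> \<omega> Y) = obj_map id_functor Y
        \<and> Cod V (\<upsilon> Y \<cdot> \<omega> Y) = obj_map M Y" if "Y \<in> Obj V" for Y
      using that by (simp add: ty[OF \<upsilon>] id_functor_def)
    fix f
    assume f: "f \<in> Arr V"
    have "(\<upsilon> (Cod V f) \<cdot> \<omega> (Cod V f)) \<cdot> f = (\<upsilon> (Cod V f) \<cdot> (Ide V \<I> \<bullet> f)) \<cdot> \<omega> (Dom V f)"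
      using f by (simp add: ty[OF \<upsilon>] omega_nat)
    also have "\<dots> = arr_map M f \<cdot> \<upsilon> (Dom V f) \<cdot> \<omega> (Dom V f)"
      using natural_transformationD(4)[OF \<upsilon> f] f
      by (simp add: ty[OF \<upsilon>] functor_typing[OF M(1)] left_tensor_def)
    finally show "(\<upsilon> (Cod V f) \<cdot> \<omega> (Cod V f)) \<cdot> arr_map id_functor f
        = arr_map M f \<cdot> \<upsilon> (Dom V f) \<cdot> \<omega> (Dom V f)"
      by (simp add: id_functor_def)
  qed
  have omega_eq: "\<sigma> X \<cdot> \<omega> X = \<tau> X \<cdot> \<omega> X"
    by (rule natural_transformations_eq_if_eq_at_generator[OF inf ls gen is_functor_id
          preserves_colimits_id comp[OF \<sigma>] comp[OF \<tau>] _ X]) (simp add: eq)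
  have I_omega: "iso V (Ide V \<I> \<bullet> \<omega> X)"
    by (rule semiunit_tensor_omega_iso[OF I X])
  have "Ide V \<I> \<bullet> \<sigma> X = Ide V \<I> \<bullet> \<tau> X"
  proof (rule iso_epic[OF I_omega])
    show "(Ide V \<I> \<bullet> \<sigma> X) \<cdot> (Ide V \<I> \<bullet> \<omega> X) = (Ide V \<I> \<bullet> \<tau> X) \<cdot> (Ide V \<I> \<bullet> \<omega> X)"
      using X by (simp add: ty[OF \<sigma>] ty[OF \<tau>] omega_eq)
  qed (use X in \<open>simp_all add: ty[OF \<sigma>] ty[OF \<tau>]\<close>)
  then show ?thesis
    using ty[OF \<sigma> X] ty[OF \<tau> X] M(2)[OF X]
    by (intro semiunit_tensor_faithful[of "\<sigma> X" "\<I> \<odot> X" "obj_map M X"]) (auto simp: in_hom)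
qed

end

section \<open>The correspondence\<close>

context semiunital_semimonoidal_category
begin

lemma semimonoid_structures_iff:
  assumes "m \<in> hom V (A \<odot> A) A" "e \<in> hom V \<I> A"
  shows "(m, e) \<in> semimonoid_structures V A \<longleftrightarrow>
    m \<cdot> (m \<bullet> Ide V A) = m \<cdot> (Ide V A \<bullet> m) \<cdot> \<gamma> A A A \<and>
    \<omega> A \<cdot> m \<cdot> (e \<bullet> Ide V A) = Ide V (\<I> \<odot> A) \<and>
    \<omega> A \<cdot> m \<cdot> (Ide V A \<bullet> e) \<cdot> \<ell> A = Ide V (\<I> \<odot> A)"
  using assms by (simp add: semimonoid_structures_def)

lemma right_multiplication_natural:
  assumes "A \<in> Obj V" "m \<in> hom V (A \<odot> A) A"
  shows "natural_transformation V V (right_tensor V A \<circ>\<^sub>F right_tensor V A) (right_tensor V A)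
    (\<lambda>X\<in>Obj V. (Ide V X \<bullet> m) \<cdot> \<gamma> X A A)"
proof (rule natural_transformationI)
  have [simp]: "A \<in> Obj V" "m \<in> Arr V" "Dom V m = A \<odot> A" "Cod V m = A"
    using assms by (auto simp: in_hom)
  fix f
  assume f [simp]: "f \<in> Arr V"
  have "\<gamma> (Cod V f) A A \<cdot> ((f \<bullet> Ide V A) \<bullet> Ide V A) = (f \<bullet> Ide V (A \<odot> A)) \<cdot> \<gamma> (Dom V f) A A"
    using assoc_natural[of f "Ide V A" "Ide V A"] by simp
  then show "(\<lambda>X\<in>Obj V. (Ide V X \<bullet> m) \<cdot> \<gamma> X A A) (Cod V f)
      \<cdot> arr_map (right_tensor V A \<circ>\<^sub>F right_tensor V A) f
      = arr_map (right_tensor V A) f \<cdot> (\<lambda>X\<in>Obj V. (Ide V X \<bullet> m) \<cdot> \<gamma> X A A) (Dom V f)"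
    by (simp add: right_tensor_def comp_functor_def)
qed (use assms in \<open>auto simp: right_tensor_def comp_functor_def in_hom\<close>)

lemma right_unit_natural:
  assumes "A \<in> Obj V" "e \<in> hom V \<I> A"
  shows "natural_transformation V V (left_tensor V \<I>) (right_tensor V A)
    (\<lambda>X\<in>Obj V. (Ide V X \<bullet> e) \<cdot> \<ell> X)"
proof (rule natural_transformationI)
  have [simp]: "A \<in> Obj V" "e \<in> Arr V" "Dom V e = \<I>" "Cod V e = A"
    using assms by (auto simp: in_hom)
  fix f
  assume f [simp]: "f \<in> Arr V"
  show "(\<lambda>X\<in>Obj V. (Ide V X \<bullet> e) \<cdot> \<ell> X) (Cod V f) \<cdot> arr_map (left_tensor V \<I>) f
      = arr_map (right_tensor V A) f \<cdot> (\<lambda>X\<in>Obj V. (Ide V X \<bullet> e) \<cdot> \<ell> X) (Dom V f)"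
    by (simp add: right_tensor_def left_tensor_def ell_nat)
qed (use assms in \<open>auto simp: right_tensor_def left_tensor_def in_hom\<close>)

lemma left_multiplication_natural:
  assumes "A \<in> Obj V" "m \<in> hom V (A \<odot> A) A"
  shows "natural_transformation V V (left_tensor V A \<circ>\<^sub>F left_tensor V A) (left_tensor V A)
    (\<lambda>X\<in>Obj V. (m \<bullet> Ide V X) \<cdot> inv_arr V (\<gamma> A A X))"
proof (rule natural_transformationI)
  have [simp]: "A \<in> Obj V" "m \<in> Arr V" "Dom V m = A \<odot> A" "Cod V m = A"
    using assms by (auto simp: in_hom)
  fix f
  assume f [simp]: "f \<in> Arr V"
  have "inv_arr V (\<gamma> A A (Cod V f)) \<cdot> (Ide V A \<bullet> (Ide V A \<bullet> f))
      = (Ide V (A \<odot> A) \<bullet> f) \<cdot> inv_arr V (\<gamma> A A (Dom V f))"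
    using inv_assoc_natural[of "Ide V A" "Ide V A" f] by simp
  then show "(\<lambda>X\<in>Obj V. (m \<bullet> Ide V X) \<cdot> inv_arr V (\<gamma> A A X)) (Cod V f)
      \<cdot> arr_map (left_tensor V A \<circ>\<^sub>F left_tensor V A) f
      = arr_map (left_tensor V A) f \<cdot> (\<lambda>X\<in>Obj V. (m \<bullet> Ide V X) \<cdot> inv_arr V (\<gamma> A A X)) (Dom V f)"
    by (simp add: left_tensor_def comp_functor_def)
qed (use assms in \<open>auto simp: left_tensor_def comp_functor_def in_hom\<close>)

lemma left_unit_natural:
  assumes "A \<in> Obj V" "e \<in> hom V \<I> A"
  shows "natural_transformation V V (left_tensor V \<I>) (left_tensor V A) (\<lambda>X\<in>Obj V. e \<bullet> Ide V X)"
  by (rule natural_transformationI) (use assms in \<open>auto simp: left_tensor_def in_hom\<close>)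

text \<open>Each monad law at \<open>X\<close> is the corresponding semimonoid law tensored with \<open>X\<close>.  The law at
  \<open>X = \<I>\<close> therefore returns the semimonoid law, because all objects involved are firm and tensoring
  with \<open>\<I>\<close> is faithful on arrows into firm objects.\<close>

lemma right_monad_of_J_monad_iff:
  assumes I: "firm V \<I>" and A: "firm V A"
    and m: "m \<in> hom V (A \<odot> A) A" and e: "e \<in> hom V \<I> A"
  shows "right_monad_of V A (m, e) \<in> J_monad_structures V (left_tensor V \<I>) \<omega> (right_tensor V A)
    \<longleftrightarrow> (m, e) \<in> semimonoid_structures V A"
proof -
  note [simp] = firm_Obj[OF A]
  have [simp]: "m \<in> Arr V" "Dom V m = A \<odot> A" "Cod V m = A" "e \<in> Arr V" "Dom V e = \<I>" "Cod V e = A"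
    using m e by (auto simp: in_hom)
  define mu where "mu = (\<lambda>X\<in>Obj V. (Ide V X \<bullet> m) \<cdot> \<gamma> X A A)"
  define nu where "nu = (\<lambda>X\<in>Obj V. (Ide V X \<bullet> e) \<cdot> \<ell> X)"
  note functors = left_tensor_functor[OF semiunit] right_tensor_functor[OF firm_Obj[OF A]]
  note natural = right_multiplication_natural[OF firm_Obj[OF A] m, folded mu_def]
    right_unit_natural[OF firm_Obj[OF A] e, folded nu_def] omega_natural
  have mu: "mu X = (Ide V X \<bullet> m) \<cdot> \<gamma> X A A" and nu: "nu X = (Ide V X \<bullet> e) \<cdot> \<ell> X"
    if "X \<in> Obj V" for X
    using that by (simp_all add: mu_def nu_def)
  have "right_monad_of V A (m, e) \<in> J_monad_structures V (left_tensor V \<I>) \<omega> (right_tensor V A)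
      \<longleftrightarrow> J_monad V (right_tensor V A) mu \<omega> nu (left_tensor V \<I>)"
    by (simp add: right_monad_of_def J_monad_structures_def mu_def nu_def)
  also have "\<dots> \<longleftrightarrow> (\<forall>X\<in>Obj V. mu X \<cdot> (mu X \<bullet> Ide V A) = mu X \<cdot> mu (X \<odot> A) \<and>
      \<omega> (X \<odot> A) \<cdot> mu X \<cdot> nu (X \<odot> A) = Ide V (\<I> \<odot> (X \<odot> A)) \<and>
      (\<omega> X \<bullet> Ide V A) \<cdot> mu X \<cdot> (nu X \<bullet> Ide V A) = Ide V ((\<I> \<odot> X) \<odot> A))"
    using functors natural unfolding J_monad_def by (simp add: left_tensor_def right_tensor_def)
  also have "\<dots> \<longleftrightarrow> (\<forall>X\<in>Obj V.
      Ide V X \<bullet> (m \<cdot> (m \<bullet> Ide V A)) = Ide V X \<bullet> (m \<cdot> (Ide V A \<bullet> m) \<cdot> \<gamma> A A A) \<and>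
      Ide V X \<bullet> (\<omega> A \<cdot> m \<cdot> (Ide V A \<bullet> e) \<cdot> \<ell> A) = Ide V (X \<odot> (\<I> \<odot> A)) \<and>
      Ide V X \<bullet> (\<omega> A \<cdot> m \<cdot> (e \<bullet> Ide V A)) = Ide V (X \<odot> (\<I> \<odot> A)))"
  proof (rule ball_cong[OF refl], intro conj_cong)
    fix X
    assume [simp]: "X \<in> Obj V"
    show "mu X \<cdot> (mu X \<bullet> Ide V A) = mu X \<cdot> mu (X \<odot> A) \<longleftrightarrow>
        Ide V X \<bullet> (m \<cdot> (m \<bullet> Ide V A)) = Ide V X \<bullet> (m \<cdot> (Ide V A \<bullet> m) \<cdot> \<gamma> A A A)"
      unfolding mu[OF \<open>X \<in> Obj V\<close>] mu[OF tensor_Obj[OF \<open>X \<in> Obj V\<close> firm_Obj[OF A]]]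
      by (rule right_associativity) simp_all
    show "\<omega> (X \<odot> A) \<cdot> mu X \<cdot> nu (X \<odot> A) = Ide V (\<I> \<odot> (X \<odot> A)) \<longleftrightarrow>
        Ide V X \<bullet> (\<omega> A \<cdot> m \<cdot> (Ide V A \<bullet> e) \<cdot> \<ell> A) = Ide V (X \<odot> (\<I> \<odot> A))"
      unfolding mu[OF \<open>X \<in> Obj V\<close>] nu[OF tensor_Obj[OF \<open>X \<in> Obj V\<close> firm_Obj[OF A]]]
      by (rule right_unit_outer) simp_all
    show "(\<omega> X \<bullet> Ide V A) \<cdot> mu X \<cdot> (nu X \<bullet> Ide V A) = Ide V ((\<I> \<odot> X) \<odot> A) \<longleftrightarrow>
        Ide V X \<bullet> (\<omega> A \<cdot> m \<cdot> (e \<bullet> Ide V A)) = Ide V (X \<odot> (\<I> \<odot> A))"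
      unfolding mu[OF \<open>X \<in> Obj V\<close>] nu[OF \<open>X \<in> Obj V\<close>]
      by (rule right_unit_inner) simp_all
  qed
  also have "\<dots> \<longleftrightarrow> (m, e) \<in> semimonoid_structures V A"
  proof -
    have law: "(\<forall>X\<in>Obj V. Ide V X \<bullet> f = Ide V X \<bullet> g) \<longleftrightarrow> f = g"
      if "f \<in> hom V X Y" "g \<in> hom V X Y" "firm V Y" for f g X Y
      using semiunit_tensor_faithful[OF that] by auto
    have IA: "firm V (\<I> \<odot> A)"
      by (rule firm_tensor_left[OF I]) simp
    have Ide: "Ide V (X \<odot> (\<I> \<odot> A)) = Ide V X \<bullet> Ide V (\<I> \<odot> A)" if "X \<in> Obj V" for X
      using that by simp
    have "(\<forall>X\<in>Obj V. Ide V X \<bullet> (m \<cdot> (m \<bullet> Ide V A)) = Ide V X \<bullet> (m \<cdot> (Ide V A \<bullet> m) \<cdot> \<gamma> A A A))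
        \<longleftrightarrow> m \<cdot> (m \<bullet> Ide V A) = m \<cdot> (Ide V A \<bullet> m) \<cdot> \<gamma> A A A"
      by (rule law[OF _ _ A, of _ "(A \<odot> A) \<odot> A"]) (auto simp: in_hom)
    moreover have "(\<forall>X\<in>Obj V. Ide V X \<bullet> (\<omega> A \<cdot> m \<cdot> (e \<bullet> Ide V A)) = Ide V X \<bullet> Ide V (\<I> \<odot> A))
        \<longleftrightarrow> \<omega> A \<cdot> m \<cdot> (e \<bullet> Ide V A) = Ide V (\<I> \<odot> A)"
      by (rule law[OF _ _ IA, of _ "\<I> \<odot> A"]) (auto simp: in_hom)
    moreover have "(\<forall>X\<in>Obj V. Ide V X \<bullet> (\<omega> A \<cdot> m \<cdot> (Ide V A \<bullet> e) \<cdot> \<ell> A) = Ide V X \<bullet> Ide V (\<I> \<odot> A))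
        \<longleftrightarrow> \<omega> A \<cdot> m \<cdot> (Ide V A \<bullet> e) \<cdot> \<ell> A = Ide V (\<I> \<odot> A)"
      by (rule law[OF _ _ IA, of _ "\<I> \<odot> A"]) (auto simp: in_hom)
    ultimately show ?thesis
      unfolding semimonoid_structures_iff[OF m e] ball_conj_distrib
      by (simp only: Ide cong: ball_cong) blast
  qed
  finally show ?thesis .
qed

text \<open>On this side \<open>\<ell>\<close> does not occur in the unit of the monad; it enters through the inner unit law,
  where \<open>A \<bullet> \<omega> X\<close> is exchanged for \<open>\<omega> A \<bullet> X\<close>.  The two unit laws trade places: the outer one now
  comes from \<open>\<mu> (\<eta> \<bullet> A)\<close> and the inner one from \<open>\<mu> (A \<bullet> \<eta>)\<close>.\<close>

lemma left_monad_of_J_monad_iff: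
  assumes I: "firm V \<I>" and A: "firm V A"
    and m: "m \<in> hom V (A \<odot> A) A" and e: "e \<in> hom V \<I> A"
  shows "left_monad_of V A (m, e) \<in> J_monad_structures V (left_tensor V \<I>) \<omega> (left_tensor V A)
    \<longleftrightarrow> (m, e) \<in> semimonoid_structures V A"
proof -
  note [simp] = firm_Obj[OF A]
  have [simp]: "m \<in> Arr V" "Dom V m = A \<odot> A" "Cod V m = A" "e \<in> Arr V" "Dom V e = \<I>" "Cod V e = A"
    using m e by (auto simp: in_hom)
  define mu where "mu = (\<lambda>X\<in>Obj V. (m \<bullet> Ide V X) \<cdot> inv_arr V (\<gamma> A A X))"
  define nu where "nu = (\<lambda>X\<in>Obj V. e \<bullet> Ide V X)"
  note functors = left_tensor_functor[OF semiunit] left_tensor_functor[OF firm_Obj[OF A]]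
  note natural = left_multiplication_natural[OF firm_Obj[OF A] m, folded mu_def]
    left_unit_natural[OF firm_Obj[OF A] e, folded nu_def] omega_natural
  have mu: "mu X = (m \<bullet> Ide V X) \<cdot> inv_arr V (\<gamma> A A X)" and nu: "nu X = e \<bullet> Ide V X"
    if "X \<in> Obj V" for X
    using that by (simp_all add: mu_def nu_def)
  have "left_monad_of V A (m, e) \<in> J_monad_structures V (left_tensor V \<I>) \<omega> (left_tensor V A)
      \<longleftrightarrow> J_monad V (left_tensor V A) mu \<omega> nu (left_tensor V \<I>)"
    by (simp add: left_monad_of_def J_monad_structures_def mu_def nu_def)
  also have "\<dots> \<longleftrightarrow> (\<forall>X\<in>Obj V. mu X \<cdot> (Ide V A \<bullet> mu X) = mu X \<cdot> mu (A \<odot> X) \<and>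
      \<omega> (A \<odot> X) \<cdot> mu X \<cdot> nu (A \<odot> X) = Ide V (\<I> \<odot> (A \<odot> X)) \<and>
      (Ide V A \<bullet> \<omega> X) \<cdot> mu X \<cdot> (Ide V A \<bullet> nu X) = Ide V (A \<odot> (\<I> \<odot> X)))"
    using functors natural unfolding J_monad_def by (simp add: left_tensor_def)
  also have "\<dots> \<longleftrightarrow> (\<forall>X\<in>Obj V.
      (m \<cdot> (m \<bullet> Ide V A)) \<bullet> Ide V X = (m \<cdot> (Ide V A \<bullet> m) \<cdot> \<gamma> A A A) \<bullet> Ide V X \<and>
      (\<omega> A \<cdot> m \<cdot> (e \<bullet> Ide V A)) \<bullet> Ide V X = Ide V ((\<I> \<odot> A) \<odot> X) \<and>
      (\<omega> A \<cdot> m \<cdot> (Ide V A \<bullet> e) \<cdot> \<ell> A) \<bullet> Ide V X = Ide V ((\<I> \<odot> A) \<odot> X))"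
  proof (rule ball_cong[OF refl], intro conj_cong)
    fix X
    assume [simp]: "X \<in> Obj V"
    show "mu X \<cdot> (Ide V A \<bullet> mu X) = mu X \<cdot> mu (A \<odot> X) \<longleftrightarrow>
        (m \<cdot> (m \<bullet> Ide V A)) \<bullet> Ide V X = (m \<cdot> (Ide V A \<bullet> m) \<cdot> \<gamma> A A A) \<bullet> Ide V X"
      unfolding mu[OF \<open>X \<in> Obj V\<close>] mu[OF tensor_Obj[OF firm_Obj[OF A] \<open>X \<in> Obj V\<close>]]
      by (rule left_associativity) simp_all
    show "\<omega> (A \<odot> X) \<cdot> mu X \<cdot> nu (A \<odot> X) = Ide V (\<I> \<odot> (A \<odot> X)) \<longleftrightarrow>
        (\<omega> A \<cdot> m \<cdot> (e \<bullet> Ide V A)) \<bullet> Ide V X = Ide V ((\<I> \<odot> A) \<odot> X)"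
      unfolding mu[OF \<open>X \<in> Obj V\<close>] nu[OF tensor_Obj[OF firm_Obj[OF A] \<open>X \<in> Obj V\<close>]]
      by (rule left_unit_outer) simp_all
    show "(Ide V A \<bullet> \<omega> X) \<cdot> mu X \<cdot> (Ide V A \<bullet> nu X) = Ide V (A \<odot> (\<I> \<odot> X)) \<longleftrightarrow>
        (\<omega> A \<cdot> m \<cdot> (Ide V A \<bullet> e) \<cdot> \<ell> A) \<bullet> Ide V X = Ide V ((\<I> \<odot> A) \<odot> X)"
      unfolding mu[OF \<open>X \<in> Obj V\<close>] nu[OF \<open>X \<in> Obj V\<close>]
      by (rule left_unit_inner) simp_all
  qed
  also have "\<dots> \<longleftrightarrow> (m, e) \<in> semimonoid_structures V A"
  proof -
    have law: "(\<forall>X\<in>Obj V. f \<bullet> Ide V X = g \<bullet> Ide V X) \<longleftrightarrow> f = g"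
      if "f \<in> hom V X Y" "g \<in> hom V X Y" "firm V Y" for f g X Y
      using tensor_semiunit_faithful[OF that] by auto
    have IA: "firm V (\<I> \<odot> A)"
      by (rule firm_tensor_left[OF I]) simp
    have Ide: "Ide V ((\<I> \<odot> A) \<odot> X) = Ide V (\<I> \<odot> A) \<bullet> Ide V X" if "X \<in> Obj V" for X
      using that by simp
    have "(\<forall>X\<in>Obj V. (m \<cdot> (m \<bullet> Ide V A)) \<bullet> Ide V X = (m \<cdot> (Ide V A \<bullet> m) \<cdot> \<gamma> A A A) \<bullet> Ide V X)
        \<longleftrightarrow> m \<cdot> (m \<bullet> Ide V A) = m \<cdot> (Ide V A \<bullet> m) \<cdot> \<gamma> A A A"
      by (rule law[OF _ _ A, of _ "(A \<odot> A) \<odot> A"]) (auto simp: in_hom)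
    moreover have "(\<forall>X\<in>Obj V. (\<omega> A \<cdot> m \<cdot> (e \<bullet> Ide V A)) \<bullet> Ide V X = Ide V (\<I> \<odot> A) \<bullet> Ide V X)
        \<longleftrightarrow> \<omega> A \<cdot> m \<cdot> (e \<bullet> Ide V A) = Ide V (\<I> \<odot> A)"
      by (rule law[OF _ _ IA, of _ "\<I> \<odot> A"]) (auto simp: in_hom)
    moreover have "(\<forall>X\<in>Obj V. (\<omega> A \<cdot> m \<cdot> (Ide V A \<bullet> e) \<cdot> \<ell> A) \<bullet> Ide V X = Ide V (\<I> \<odot> A) \<bullet> Ide V X)
        \<longleftrightarrow> \<omega> A \<cdot> m \<cdot> (Ide V A \<bullet> e) \<cdot> \<ell> A = Ide V (\<I> \<odot> A)"
      by (rule law[OF _ _ IA, of _ "\<I> \<odot> A"]) (auto simp: in_hom)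
    ultimately show ?thesis
      unfolding semimonoid_structures_iff[OF m e] ball_conj_distrib
      by (simp only: Ide cong: ball_cong)
  qed
  finally show ?thesis .
qed

text \<open>Fullness of \<open>\<I> \<bullet> -\<close> on firm objects reads \<open>\<mu>\<close> and \<open>\<eta>\<close> off the components at \<open>\<I>\<close> of a given
  monad structure, and faithfulness makes them unique.  The structure induced by them agrees with the
  given one at \<open>\<I>\<close>, hence everywhere.\<close>

lemma right_monad_of_bij:
  assumes inf: "infinite (UNIV :: 'u set)"
    and ls: "locally_small TYPE('u) V" and gen: "regular_generator V \<I>"
    and I: "firm V \<I>" and A: "firm V A"
    and pres: "preserves_colimits TYPE('u) V V (right_tensor V A)"
  shows "bij_betw (right_monad_of V A) (semimonoid_structures V A)
    (J_monad_structures V (left_tensor V \<I>) \<omega> (right_tensor V A))"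
proof (rule bij_betw_imageI)
  note AO [simp] = firm_Obj[OF A]
  note AA = firm_tensor_left[OF A AO]
  note endo = right_tensor_functor[OF AO]
  have typed: "m \<in> hom V (A \<odot> A) A" "e \<in> hom V \<I> A" if "(m, e) \<in> semimonoid_structures V A" for m e
    using that unfolding semimonoid_structures_def by blast+
  show "inj_on (right_monad_of V A) (semimonoid_structures V A)"
  proof (rule inj_onI, clarify)
    fix m e m' e'
    assume s: "(m, e) \<in> semimonoid_structures V A" "(m', e') \<in> semimonoid_structures V A"
      and eq: "right_monad_of V A (m, e) = right_monad_of V A (m', e')"
    note t = typed[OF s(1)] typed[OF s(2)]
    have at_I: "(Ide V \<I> \<bullet> m) \<cdot> \<gamma> \<I> A A = (Ide V \<I> \<bullet> m') \<cdot> \<gamma> \<I> A A"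
      "(Ide V \<I> \<bullet> e) \<cdot> \<ell> \<I> = (Ide V \<I> \<bullet> e') \<cdot> \<ell> \<I>"
      using arg_cong[OF eq, of "\<lambda>p. fst p \<I>"] arg_cong[OF eq, of "\<lambda>p. snd p \<I>"]
      by (simp_all add: right_monad_of_def)
    have "Ide V \<I> \<bullet> m = Ide V \<I> \<bullet> m'"
      by (rule iso_epic[OF _ at_I(1)]) (use t in \<open>auto simp: in_hom\<close>)
    moreover have "Ide V \<I> \<bullet> e = Ide V \<I> \<bullet> e'"
      by (rule iso_epic[OF _ at_I(2)]) (use t in \<open>auto simp: in_hom\<close>)
    ultimately show "m = m' \<and> e = e'"
      using semiunit_tensor_faithful[OF _ _ A] t by blast
  qed
  have onto: "p \<in> right_monad_of V A ` semimonoid_structures V A"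
    if p: "p \<in> J_monad_structures V (left_tensor V \<I>) \<omega> (right_tensor V A)" for p
  proof -
    obtain mu nu where p_eq: "p = (mu, nu)"
      by (cases p)
    have ext: "mu \<in> extensional (Obj V)" "nu \<in> extensional (Obj V)"
      and mu: "natural_transformation V V (right_tensor V A \<circ>\<^sub>F right_tensor V A) (right_tensor V A) mu"
      and nu: "natural_transformation V V (left_tensor V \<I>) (right_tensor V A) nu"
      using p unfolding p_eq J_monad_structures_def J_monad_def by blast+
    have mu_I: "mu \<I> \<in> Arr V" "Dom V (mu \<I>) = (\<I> \<odot> A) \<odot> A" "Cod V (mu \<I>) = \<I> \<odot> A"
      using natural_transformationD(1-3)[OF mu semiunit]
      by (simp_all add: right_tensor_def comp_functor_def)
    have nu_I: "nu \<I> \<in> Arr V" "Dom V (nu \<I>) = \<I> \<odot> \<I>" "Cod V (nu \<I>) = \<I> \<odot> A"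
      using natural_transformationD(1-3)[OF nu semiunit]
      by (simp_all add: right_tensor_def left_tensor_def)
    obtain m where m: "m \<in> hom V (A \<odot> A) A" "Ide V \<I> \<bullet> m = mu \<I> \<cdot> inv_arr V (\<gamma> \<I> A A)"
      by (rule semiunit_tensor_full[OF _ AA A, of "mu \<I> \<cdot> inv_arr V (\<gamma> \<I> A A)"])
        (auto simp: in_hom mu_I)
    obtain e where e: "e \<in> hom V \<I> A" "Ide V \<I> \<bullet> e = nu \<I> \<cdot> inv_arr V (\<ell> \<I>)"
      by (rule semiunit_tensor_full[OF _ I A, of "nu \<I> \<cdot> inv_arr V (\<ell> \<I>)"])
        (auto simp: in_hom nu_I)
    have "mu X = (\<lambda>X\<in>Obj V. (Ide V X \<bullet> m) \<cdot> \<gamma> X A A) X" if X: "X \<in> Obj V" for X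
      by (rule natural_transformations_eq_if_eq_at_generator[OF inf ls gen
            is_functor_comp[OF endo endo] preserves_colimits_comp[OF endo pres pres]
            mu right_multiplication_natural[OF AO m(1)] _ X])
        (simp add: m(2) mu_I)
    moreover have "nu X = (\<lambda>X\<in>Obj V. (Ide V X \<bullet> e) \<cdot> \<ell> X) X" if X: "X \<in> Obj V" for X
      by (rule transformations_from_J_eq_if_eq_at_semiunit[OF inf ls gen I endo _
            nu right_unit_natural[OF AO e(1)] _ X])
        (simp_all add: e(2) nu_I right_tensor_def firm_tensor_right[OF A])
    ultimately have "mu = (\<lambda>X\<in>Obj V. (Ide V X \<bullet> m) \<cdot> \<gamma> X A A)"
      "nu = (\<lambda>X\<in>Obj V. (Ide V X \<bullet> e) \<cdot> \<ell> X)"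
      using ext by (blast intro: extensionalityI[OF _ restrict_extensional])+
    then have "right_monad_of V A (m, e) = p"
      by (simp add: p_eq right_monad_of_def)
    then show ?thesis
      using p right_monad_of_J_monad_iff[OF I A m(1) e(1)] by (intro image_eqI[of _ _ "(m, e)"]) simp_all
  qed
  show "right_monad_of V A ` semimonoid_structures V A
      = J_monad_structures V (left_tensor V \<I>) \<omega> (right_tensor V A)"
  proof (intro equalityI subsetI)
    fix p
    assume "p \<in> right_monad_of V A ` semimonoid_structures V A"
    then obtain m e where s: "(m, e) \<in> semimonoid_structures V A" and p: "p = right_monad_of V A (m, e)"
      by auto
    show "p \<in> J_monad_structures V (left_tensor V \<I>) \<omega> (right_tensor V A)"
      unfolding p right_monad_of_J_monad_iff[OF I A typed[OF s]] by (rule s)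
  qed (rule onto)
qed

text \<open>The components at \<open>\<I>\<close> are now of the form \<open>g \<bullet> \<I>\<close>, so it is \<open>- \<bullet> \<I>\<close>, the conjugate of \<open>\<I> \<bullet> -\<close>
  by \<open>\<ell>\<close>, whose fullness and faithfulness on firm objects serve here.\<close>

lemma left_monad_of_bij:
  assumes inf: "infinite (UNIV :: 'u set)"
    and ls: "locally_small TYPE('u) V" and gen: "regular_generator V \<I>"
    and I: "firm V \<I>" and A: "firm V A"
    and pres: "preserves_colimits TYPE('u) V V (left_tensor V A)"
  shows "bij_betw (left_monad_of V A) (semimonoid_structures V A)
    (J_monad_structures V (left_tensor V \<I>) \<omega> (left_tensor V A))"
proof (rule bij_betw_imageI)
  note AO [simp] = firm_Obj[OF A]
  note AA = firm_tensor_left[OF A AO]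
  note endo = left_tensor_functor[OF AO]
  have typed: "m \<in> hom V (A \<odot> A) A" "e \<in> hom V \<I> A" if "(m, e) \<in> semimonoid_structures V A" for m e
    using that unfolding semimonoid_structures_def by blast+
  show "inj_on (left_monad_of V A) (semimonoid_structures V A)"
  proof (rule inj_onI, clarify)
    fix m e m' e'
    assume s: "(m, e) \<in> semimonoid_structures V A" "(m', e') \<in> semimonoid_structures V A"
      and eq: "left_monad_of V A (m, e) = left_monad_of V A (m', e')"
    note t = typed[OF s(1)] typed[OF s(2)]
    have at_I: "(m \<bullet> Ide V \<I>) \<cdot> inv_arr V (\<gamma> A A \<I>) = (m' \<bullet> Ide V \<I>) \<cdot> inv_arr V (\<gamma> A A \<I>)"
      "e \<bullet> Ide V \<I> = e' \<bullet> Ide V \<I>"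
      using arg_cong[OF eq, of "\<lambda>p. fst p \<I>"] arg_cong[OF eq, of "\<lambda>p. snd p \<I>"]
      by (simp_all add: left_monad_of_def)
    have "m \<bullet> Ide V \<I> = m' \<bullet> Ide V \<I>"
      by (rule iso_epic[OF _ at_I(1)]) (use t in \<open>auto simp: in_hom\<close>)
    with at_I(2) show "m = m' \<and> e = e'"
      using tensor_semiunit_faithful[OF _ _ A] t by blast
  qed
  have onto: "p \<in> left_monad_of V A ` semimonoid_structures V A"
    if p: "p \<in> J_monad_structures V (left_tensor V \<I>) \<omega> (left_tensor V A)" for p
  proof -
    obtain mu nu where p_eq: "p = (mu, nu)"
      by (cases p)
    have ext: "mu \<in> extensional (Obj V)" "nu \<in> extensional (Obj V)"
      and mu: "natural_transformation V V (left_tensor V A \<circ>\<^sub>F left_tensor V A) (left_tensor V A) mu"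
      and nu: "natural_transformation V V (left_tensor V \<I>) (left_tensor V A) nu"
      using p unfolding p_eq J_monad_structures_def J_monad_def by blast+
    have mu_I: "mu \<I> \<in> Arr V" "Dom V (mu \<I>) = A \<odot> (A \<odot> \<I>)" "Cod V (mu \<I>) = A \<odot> \<I>"
      using natural_transformationD(1-3)[OF mu semiunit]
      by (simp_all add: left_tensor_def comp_functor_def)
    have nu_I: "nu \<I> \<in> Arr V" "Dom V (nu \<I>) = \<I> \<odot> \<I>" "Cod V (nu \<I>) = A \<odot> \<I>"
      using natural_transformationD(1-3)[OF nu semiunit] by (simp_all add: left_tensor_def)
    obtain m where m: "m \<in> hom V (A \<odot> A) A" "m \<bullet> Ide V \<I> = mu \<I> \<cdot> \<gamma> A A \<I>"
      by (rule tensor_semiunit_full[OF _ AA A, of "mu \<I> \<cdot> \<gamma> A A \<I>"]) (auto simp: in_hom mu_I)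
    obtain e where e: "e \<in> hom V \<I> A" "e \<bullet> Ide V \<I> = nu \<I>"
      by (rule tensor_semiunit_full[OF _ I A, of "nu \<I>"]) (auto simp: in_hom nu_I)
    have "mu X = (\<lambda>X\<in>Obj V. (m \<bullet> Ide V X) \<cdot> inv_arr V (\<gamma> A A X)) X" if X: "X \<in> Obj V" for X
      by (rule natural_transformations_eq_if_eq_at_generator[OF inf ls gen
            is_functor_comp[OF endo endo] preserves_colimits_comp[OF endo pres pres]
            mu left_multiplication_natural[OF AO m(1)] _ X])
        (simp add: m(2) mu_I)
    moreover have "nu X = (\<lambda>X\<in>Obj V. e \<bullet> Ide V X) X" if X: "X \<in> Obj V" for X
      by (rule transformations_from_J_eq_if_eq_at_semiunit[OF inf ls gen I endo _
            nu left_unit_natural[OF AO e(1)] _ X])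
        (simp_all add: e(2) nu_I left_tensor_def firm_tensor_left[OF A])
    ultimately have "mu = (\<lambda>X\<in>Obj V. (m \<bullet> Ide V X) \<cdot> inv_arr V (\<gamma> A A X))"
      "nu = (\<lambda>X\<in>Obj V. e \<bullet> Ide V X)"
      using ext by (blast intro: extensionalityI[OF _ restrict_extensional])+
    then have "left_monad_of V A (m, e) = p"
      by (simp add: p_eq left_monad_of_def)
    then show ?thesis
      using p left_monad_of_J_monad_iff[OF I A m(1) e(1)] by (intro image_eqI[of _ _ "(m, e)"]) simp_all
  qed
  show "left_monad_of V A ` semimonoid_structures V A
      = J_monad_structures V (left_tensor V \<I>) \<omega> (left_tensor V A)"
  proof (intro equalityI subsetI)
    fix p
    assume "p \<in> left_monad_of V A ` semimonoid_structures V A"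
    then obtain m e where s: "(m, e) \<in> semimonoid_structures V A" and p: "p = left_monad_of V A (m, e)"
      by auto
    show "p \<in> J_monad_structures V (left_tensor V \<I>) \<omega> (left_tensor V A)"
      unfolding p left_monad_of_J_monad_iff[OF I A typed[OF s]] by (rule s)
  qed (rule onto)
qed

end

theorem theorem4p8:
  fixes V :: "('o, 'm, 'x) semiunital_data_scheme"
    and A :: 'o
  assumes "infinite (UNIV :: 'u set)"
    and "semiunital_semimonoidal_category V"
    and "locally_small TYPE('u) V"
    and "cocomplete TYPE('u) V"
    and "firm V (semiunit V)"
    and "firm V A"
    and "regular_generator V (semiunit V)"
    and "preserves_colimits TYPE('u) V V (left_tensor V A)"
    and "preserves_colimits TYPE('u) V V (right_tensor V A)"
  shows "bij_betw (right_monad_of V A)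
           (semimonoid_structures V A)
           (J_monad_structures V (left_tensor V (semiunit V)) (omega V) (right_tensor V A))
       \<and> bij_betw (left_monad_of V A)
           (semimonoid_structures V A)
           (J_monad_structures V (left_tensor V (semiunit V)) (omega V) (left_tensor V A))"
proof -
  interpret semiunital_semimonoidal_category V
    by fact
  show ?thesis
    using right_monad_of_bij[OF assms(1,3,7,5,6,9)] left_monad_of_bij[OF assms(1,3,7,5,6,8)] by blast
qed

end
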